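(* For every $\epsilon > 0$ there exists $c > 0$ such that for every finite set $A \subset \mathbb{R}$, \[ \max\left\{ |A+A|,\ |AA| \right\} \geq c\,|A|^{\frac{4}{3} + \frac{10}{4407} - \epsilon}. \]
   Context: For finite $A \subset \mathbb{R}$, $A+A = \{a_1+a_2 : a_1,a_2 \in A\}$ and $AA = \{a_1 a_2 : a_1,a_2\in A\}$. *)

theory Defs
  imports Complex_Main
begin

definition sumset :: "real set \<Rightarrow> real set" where
  "sumset A = {a1 + a2 | a1 a2. a1 \<in> A \<and> a2 \<in> A}"

definition prodset :: "real set \<Rightarrow> real set" where
  "prodset A = {a1 * a2 | a1 a2. a1 \<in> A \<and> a2 \<in> A}"

end

theory Submission
  imports Defs "HOL-Analysis.Convex"
begin

text \<open>The slopes \<open>\<lambda>\<close> of the lines through the origin carrying about \<open>\<tau>\<close> points of \<open>A \<times> A\<close> account for the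
  multiplicative energy, which is at least \<open>|A|\<^sup>4 / |AA|\<close>. Following Solymosi, Konyagin and Shkredov, if
  \<open>|A + A|\<close> is only slightly larger than \<open>|A|\<^bsup>4/3\<^esup>\<close>, then sums of points on nearby lines must coincide often,
  and some four slopes \<open>\<lambda>\<^sub>1, \<dots>, \<lambda>\<^sub>4\<close> yield many solutions of a linear equation
  \<open>c\<^sub>1 p\<^sub>1 + c\<^sub>2 p\<^sub>2 = c\<^sub>3 p\<^sub>3\<close> with \<open>p\<^sub>i \<in> A \<inter> \<lambda>\<^sub>i\<^sup>-\<^sup>1 A\<close>. The additive structure of these sets forces their
  multiplicative energy to be small (Elekes and Ruzsa), so dilating the solutions by the elements of \<open>A\<close>
  produces almost \<open>|A|\<close> times as many solutions inside \<open>AA\<close>. But a typical product \<open>a p\<close> has many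
  representations \<open>x / \<mu>\<close> with \<open>x \<in> AA\<close> and \<open>\<mu>\<close> a popular slope, and then the Szemeredi--Trotter bound for
  Cartesian products rules out so many solutions. Quantitatively this gives, up to logarithms,
  \<open>|A|\<^bsup>159\<^esup> \<le> max(|A + A|, |AA|)\<^bsup>119\<^esup>\<close>, and \<open>159/119 = 4/3 + 1/357 > 4/3 + 10/4407\<close>.\<close>

subsection \<open>Incidences in Cartesian products\<close>

text \<open>Up to constants and logarithms, put n = |A|, M = max(|A + A|, |AA|), z = M^3 / n^4,
  sigma = |S|. The energy gives sigma tau^2 >= n^4 / M, so blocks of N = |A + A|^2 / (sigma tau^2)
  <= z consecutive slopes already force coincidences: near exponent 4/3 whatever depends on N costs
  only powers of z. Pigeonholing over the blocks leaves w >= n tau^2 / z^2 solutions; they have x >=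
  w^6 / (n^5 tau^10) dilates, while incidences give x^3 sigma <= M^6. Eliminating w and x yields n^3
  sigma tau^6 <= z^36 M^6. With tau >= n^2 / M this becomes n^15 <= z^36 M^11, the origin of 159 =
  15 + 4 * 36 and 119 = 11 + 3 * 36.

  The obstacle is the order of choices: the four slopes appear only through a pigeonhole, but the
  incidence bound needs the products \<open>a p\<close> on them to be popular. Hence popularity is
  imposed on all slopes beforehand, through sets \<open>G l\<close> of pairs \<open>(a, p)\<close>,
  and only sums with a common \<open>a\<close> are compared, so that each coincidence is a solution
  together with an admissible dilation.\<close>

lemma card_eq_sum_fibres:
  assumes "finite X" "finite Y" "f ` X \<subseteq> Y"
  shows "card X = (\<Sum>y\<in>Y. card {x\<in>X. f x = y})"
proof -
  have "card X = (\<Sum>x\<in>X. 1)" by simp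
  also have "\<dots> = (\<Sum>y\<in>Y. \<Sum>x\<in>{x\<in>X. f x = y}. 1)"
    by (rule sum.group[symmetric]) (use assms in auto)
  finally show ?thesis by simp
qed

lemma card_collisions_eq_sum:
  assumes "finite X" "finite Y" "f ` X \<subseteq> Y"
  shows "card {(x, x'). x \<in> X \<and> x' \<in> X \<and> f x = f x'} = (\<Sum>y\<in>Y. card {x\<in>X. f x = y} ^ 2)"
proof -
  have "{(x, x'). x \<in> X \<and> x' \<in> X \<and> f x = f x'} = (\<Union>y\<in>Y. {x\<in>X. f x = y} \<times> {x\<in>X. f x = y})"
    using assms(3) by auto
  moreover have "card (\<Union>y\<in>Y. {x\<in>X. f x = y} \<times> {x\<in>X. f x = y})
      = (\<Sum>y\<in>Y. card ({x\<in>X. f x = y} \<times> {x\<in>X. f x = y}))"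
    by (rule card_UN_disjoint) (use assms in auto)
  ultimately show ?thesis by (simp add: card_cartesian_product power2_eq_square)
qed

text \<open>Cauchy-Schwarz for the fibre sizes. It is read in both directions below: few values
  force many collisions, and few collisions force many values.\<close>

lemma card_square_le_collisions:
  assumes "finite X" "finite Y" "f ` X \<subseteq> Y"
  shows "real (card X) ^ 2 \<le> real (card Y) * real (card {(x, x'). x \<in> X \<and> x' \<in> X \<and> f x = f x'})"
proof -
  have "real (card X) = (\<Sum>y\<in>Y. real (card {x\<in>X. f x = y}))"
    using card_eq_sum_fibres[OF assms] by simp
  then have "real (card X) ^ 2 \<le> (\<Sum>y\<in>Y. real (card {x\<in>X. f x = y}) ^ 2) * real (card Y)"
    using sum_squared_le_sum_of_squares[of "\<lambda>y. real (card {x\<in>X. f x = y})" Y] assms(2)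
    by (cases "Y = {}") (auto simp: mult.commute)
  then show ?thesis
    using card_collisions_eq_sum[OF assms] by (simp add: mult.commute)
qed

lemma card_le_mult_fibres:
  assumes "finite X" "finite Y" "f ` X \<subseteq> Y" "\<And>y. y \<in> Y \<Longrightarrow> real (card {x\<in>X. f x = y}) \<le> c"
  shows "real (card X) \<le> c * real (card Y)"
proof -
  have "real (card X) = (\<Sum>y\<in>Y. real (card {x\<in>X. f x = y}))"
    using card_eq_sum_fibres[OF assms(1-3)] by simp
  also have "\<dots> \<le> (\<Sum>y\<in>Y. c)" by (rule sum_mono) (use assms(4) in auto)
  finally show ?thesis by (simp add: mult.commute)
qed

text \<open>Each value loses fewer than \<open>c\<close> elements or none. With \<open>c\<close> a
  small fraction of the average fibre size most of \<open>X\<close> survives, and every survivor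
  shares its value with at least \<open>c\<close> elements of \<open>X\<close>.\<close>

lemma card_light_fibres_le:
  assumes "finite X" "finite Y" "f ` X \<subseteq> Y" "0 \<le> c"
  shows "real (card {x\<in>X. real (card {x'\<in>X. f x' = f x}) < c}) \<le> c * real (card Y)"
proof (rule card_le_mult_fibres[where f = f])
  show "real (card {x \<in> {x\<in>X. real (card {x'\<in>X. f x' = f x}) < c}. f x = y}) \<le> c" if "y \<in> Y" for y
  proof (cases "\<exists>x\<in>X. f x = y \<and> real (card {x'\<in>X. f x' = f x}) < c")
    case True
    then obtain x where x: "x \<in> X" "f x = y" "real (card {x'\<in>X. f x' = f x}) < c" by auto
    have "{x \<in> {x\<in>X. real (card {x'\<in>X. f x' = f x}) < c}. f x = y} \<subseteq> {x'\<in>X. f x' = f x}"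
      using x by auto
    then have "card {x \<in> {x\<in>X. real (card {x'\<in>X. f x' = f x}) < c}. f x = y} \<le> card {x'\<in>X. f x' = f x}"
      using assms(1) by (intro card_mono) auto
    then show ?thesis using x(3) by simp
  next
    case False
    then have "{x \<in> {x\<in>X. real (card {x'\<in>X. f x' = f x}) < c}. f x = y} = {}" by auto
    then show ?thesis using assms(4) by (simp only: card.empty of_nat_0)
  qed
qed (use assms in auto)

text \<open>The pair \<open>l\<close> is (slope, intercept), and an incidence is recorded by its
  abscissa. Vertical lines have no code and the incidence lemmas exclude horizontal ones, so either
  coordinate of a point on the line determines the other.\<close>

definition line_points :: "real set \<Rightarrow> real set \<Rightarrow> real \<times> real \<Rightarrow> real set" where
  "line_points X Y l = {x \<in> X. fst l * x + snd l \<in> Y}"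

lemma finite_line_points [simp]: "finite X \<Longrightarrow> finite (line_points X Y l)"
  by (simp add: line_points_def)

lemma card_line_points_le:
  assumes "finite X" "finite Y" "fst l \<noteq> 0"
  shows "card (line_points X Y l) \<le> card X" "card (line_points X Y l) \<le> card Y"
proof -
  show "card (line_points X Y l) \<le> card X"
    by (rule card_mono) (use assms in \<open>auto simp: line_points_def\<close>)
  have "inj_on (\<lambda>x. fst l * x + snd l) (line_points X Y l)"
    using assms(3) by (auto intro!: inj_onI)
  then show "card (line_points X Y l) \<le> card Y"
    by (rule card_inj_on_le) (use assms in \<open>auto simp: line_points_def\<close>)
qed

text \<open>The rank of \<open>x\<close> in \<open>X\<close> divided by \<open>g\<close>: blocks are
  runs of consecutive elements, whatever their spacing. Coordinates are cut up this way for the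
  incidence bound, and slopes for the coincidences of sums.\<close>

definition block_index :: "real set \<Rightarrow> nat \<Rightarrow> real \<Rightarrow> nat" where
  "block_index X g x = card {y \<in> X. y < x} div g"

lemma block_index_mono:
  assumes "finite X" "x \<le> y"
  shows "block_index X g x \<le> block_index X g y"
  unfolding block_index_def by (intro div_le_mono card_mono) (use assms in auto)

lemma block_index_less:
  assumes "finite X" "x \<in> X" "card X \<le> k * g"
  shows "block_index X g x < k"
proof -
  have "card {y \<in> X. y < x} < card X"
    by (rule psubset_card_mono) (use assms in auto)
  then have "card {y \<in> X. y < x} < k * g" using assms(3) by linarith
  then show ?thesis
    unfolding block_index_def by (rule less_mult_imp_div_less)
qed

lemma card_block_index_fibre:
  assumes "finite X" "g > 0"
  shows "card {x\<in>X. block_index X g x = i} \<le> g"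
proof -
  have "inj_on (\<lambda>x. card {y \<in> X. y < x}) X"
  proof (rule linorder_inj_onI')
    fix x y assume "x \<in> X" "y \<in> X" "x < y"
    then have "card {z \<in> X. z < x} < card {z \<in> X. z < y}"
      by (intro psubset_card_mono) (use assms in auto)
    then show "card {z \<in> X. z < x} \<noteq> card {z \<in> X. z < y}" by simp
  qed
  then have "inj_on (\<lambda>x. card {y \<in> X. y < x}) {x\<in>X. block_index X g x = i}"
    by (rule inj_on_subset) auto
  moreover have "(\<lambda>x. card {y \<in> X. y < x}) ` {x\<in>X. block_index X g x = i} \<subseteq> {i * g ..< i * g + g}"
  proof (rule image_subsetI)
    fix x assume "x \<in> {x\<in>X. block_index X g x = i}"
    then have "card {y \<in> X. y < x} div g = i" by (simp only: block_index_def mem_Collect_eq)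
    then show "card {y \<in> X. y < x} \<in> {i * g ..< i * g + g}"
      using dividend_less_div_times[OF assms(2), of "card {y \<in> X. y < x}"] by (auto simp: add.commute)
  qed
  ultimately have "card {x\<in>X. block_index X g x = i} \<le> card {i * g ..< i * g + g}"
    by (rule card_inj_on_le) auto
  then show ?thesis by simp
qed

text \<open>The group size exceeds \<open>card X / k\<close>, which keeps the number of intervals at
  most \<open>k\<close>. The rounding term is harmless as long as
  \<open>k \<le> card X\<close>.\<close>

definition interval_index :: "real set \<Rightarrow> nat \<Rightarrow> real \<Rightarrow> nat" where
  "interval_index X k = block_index X (card X div k + 1)"

lemma interval_index_mono:
  assumes "finite X" "x \<le> y"
  shows "interval_index X k x \<le> interval_index X k y"
  unfolding interval_index_def using assms by (rule block_index_mono)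

lemma interval_index_less:
  assumes "finite X" "x \<in> X" "k > 0"
  shows "interval_index X k x < k"
  unfolding interval_index_def
  using assms(1,2)
proof (rule block_index_less)
  show "card X \<le> k * (card X div k + 1)"
    using dividend_less_times_div[OF assms(3), of "card X"] by simp
qed

lemma card_interval_index_fibre:
  assumes "finite X"
  shows "card {x\<in>X. interval_index X k x = i} \<le> card X div k + 1"
  unfolding interval_index_def using assms by (rule card_block_index_fibre) simp

lemma card_same_interval_pairs:
  assumes "finite X" "k > 0" "k \<le> card X"
  shows "real (card {(x, x'). x \<in> X \<and> x' \<in> X \<and> interval_index X k x = interval_index X k x'})
    \<le> 2 * real (card X) ^ 2 / real k"
proof -
  let ?P = "{(x, x'). x \<in> X \<and> x' \<in> X \<and> interval_index X k x = interval_index X k x'}"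
  have "real (card ?P) \<le> real (card X div k + 1) * real (card X)"
  proof (rule card_le_mult_fibres[where f = fst])
    show "finite ?P" by (rule finite_subset[of _ "X \<times> X"]) (use assms in auto)
    fix x assume x: "x \<in> X"
    have "{p \<in> ?P. fst p = x} = Pair x ` {x'\<in>X. interval_index X k x' = interval_index X k x}"
      using x by auto
    then have "card {p \<in> ?P. fst p = x} = card {x'\<in>X. interval_index X k x' = interval_index X k x}"
      by (simp add: card_image inj_on_def)
    then show "real (card {p \<in> ?P. fst p = x}) \<le> real (card X div k + 1)"
      using card_interval_index_fibre[OF assms(1), of k "interval_index X k x"] by linarith
  qed (use assms in auto)
  also have "real (card X div k + 1) \<le> 2 * real (card X) / real k"
  proof -
    have "real (card X div k) \<le> real (card X) / real k"
      by (simp add: of_nat_div_le_of_nat)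
    moreover have "1 \<le> real (card X) / real k" using assms by simp
    ultimately show ?thesis by simp
  qed
  then have "real (card X div k + 1) * real (card X) \<le> 2 * real (card X) / real k * real (card X)"
    by (rule mult_right_mono) simp
  finally show ?thesis by (simp add: power2_eq_square)
qed

text \<open>A line meets at most \<open>2 k\<close> of the \<open>k\<^sup>2\<close> cells, so a line with many more points than that
  has many pairs of points sharing a cell, and a pair of points determines its line.\<close>

lemma line_same_cell_pairs:
  assumes fin: "finite X" "finite Y" and m: "fst l \<noteq> 0" and k: "k > 0" "4 * k \<le> card (line_points X Y l)"
  shows "real (card (line_points X Y l)) ^ 2 / (4 * real k) \<le>
    real (card {(x, x'). x \<in> line_points X Y l \<and> x' \<in> line_points X Y l \<and> x \<noteq> x' \<and>
       interval_index X k x = interval_index X k x' \<and>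
       interval_index Y k (fst l * x + snd l) = interval_index Y k (fst l * x' + snd l)})"
    (is "_ \<le> real (card ?D)")
proof -
  let ?P = "line_points X Y l" and ?y = "\<lambda>x. fst l * x + snd l"
  define c where "c x = interval_index X k x" for x
  define d where "d x = interval_index Y k (?y x)" for x
  \<comment> \<open>Along a line both indices are monotone, in opposite directions if the slope is
    negative; there \<open>d\<close> is reversed. So the two summands of \<open>key\<close> grow
    together and equal keys force equal cells, while \<open>key\<close> has only
    \<open>2 * k\<close> values.\<close>
  define key where "key x = (if fst l > 0 then c x + d x else c x + (k - 1 - d x))" for x
  have dk: "d x < k" "c x < k" if "x \<in> ?P" for x
    using that interval_index_less fin k unfolding d_def c_def line_points_def by auto
  have key: "key ` ?P \<subseteq> {..<2 * k}"
    unfolding key_def using dk by fastforce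
  have cm: "c x \<le> c x'" if "x \<le> x'" for x x'
    using that interval_index_mono fin unfolding c_def by auto
  have dm: "d x \<le> d x'" if "x \<le> x'" "fst l > 0" for x x'
    using that interval_index_mono fin unfolding d_def by auto
  have dm': "d x' \<le> d x" if "x \<le> x'" "fst l < 0" for x x'
    using that interval_index_mono fin unfolding d_def by (auto simp: mult_left_mono_neg)
  have same: "c x = c x' \<and> d x = d x'" if "x \<in> ?P" "x' \<in> ?P" "key x = key x'" "x \<le> x'" for x x'
  proof (cases "fst l > 0")
    case True
    then show ?thesis using that cm[of x x'] dm[of x x'] unfolding key_def by auto
  next
    case False
    then have "fst l < 0" using m by auto
    then show ?thesis using that cm[of x x'] dm'[of x x'] dk[of x] dk[of x'] unfolding key_def by auto
  qed
  have sub: "{(x, x'). x \<in> ?P \<and> x' \<in> ?P \<and> key x = key x'} \<subseteq> ?D \<union> (\<lambda>x. (x, x)) ` ?P"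
  proof
    fix p assume "p \<in> {(x, x'). x \<in> ?P \<and> x' \<in> ?P \<and> key x = key x'}"
    then obtain x x' where p: "p = (x, x')" and *: "x \<in> ?P" "x' \<in> ?P" "key x = key x'" by auto
    have "c x = c x' \<and> d x = d x'"
    proof (cases "x \<le> x'")
      case True
      then show ?thesis using same[of x x'] *(1-3) by blast
    next
      case False
      then show ?thesis using same[OF *(2,1) *(3)[symmetric]] by (metis linorder_le_cases)
    qed
    then show "p \<in> ?D \<union> (\<lambda>x. (x, x)) ` ?P"
      using *(1,2) unfolding c_def d_def p by blast
  qed
  have finD: "finite ?D" by (rule finite_subset[of _ "?P \<times> ?P"]) (use fin in auto)
  have "card {(x, x'). x \<in> ?P \<and> x' \<in> ?P \<and> key x = key x'} \<le> card (?D \<union> (\<lambda>x. (x, x)) ` ?P)"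
    by (rule card_mono[OF _ sub]) (use finD fin in auto)
  also have "\<dots> \<le> card ?D + card ((\<lambda>x. (x, x)) ` ?P)" by (rule card_Un_le)
  also have "card ((\<lambda>x. (x, x)) ` ?P) \<le> card ?P" by (rule card_image_le) (use fin in auto)
  finally have 1: "real (card {(x, x'). x \<in> ?P \<and> x' \<in> ?P \<and> key x = key x'}) \<le> real (card ?D) + real (card ?P)"
    by linarith
  have "real (card ?P) ^ 2 \<le> real (card {..<2 * k}) * real (card {(x, x'). x \<in> ?P \<and> x' \<in> ?P \<and> key x = key x'})"
    by (rule card_square_le_collisions) (use fin key in auto)
  also have "\<dots> \<le> 2 * real k * (real (card ?D) + real (card ?P))"
    using 1 by (simp add: mult_left_mono)
  finally have "real (card ?P) ^ 2 / (2 * real k) \<le> real (card ?D) + real (card ?P)"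
    using k by (simp add: divide_simps mult.commute)
  \<comment> \<open>The diagonal pairs \<open>(x, x)\<close> are at most half of the Cauchy-Schwarz
    bound because the line has at least \<open>4 * k\<close> points.\<close>
  moreover have "real (card ?P) \<le> real (card ?P) ^ 2 / (4 * real k)"
  proof -
    have "4 * real k \<le> real (card ?P)" using k(2) by linarith
    then have "real (card ?P) * (4 * real k) \<le> real (card ?P) * real (card ?P)"
      by (rule mult_left_mono) simp
    then show ?thesis using k by (simp add: field_simps power2_eq_square)
  qed
  moreover have "real (card ?P) ^ 2 / (2 * real k) = real (card ?P) ^ 2 / (4 * real k) + real (card ?P) ^ 2 / (4 * real k)"
    by (simp add: field_simps)
  ultimately show ?thesis by linarith
qed

text \<open>Take \<open>k\<close> about \<open>r / 4\<close>. A line with P points contains at least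
  P^2 / (4 k) ordered pairs of distinct points in a common cell, these pairs differ for different
  lines, and the grid has at most 4 (|X| |Y|)^2 / k^2 pairs sharing a cell. The rounding loss
  \<open>r / 8 \<le> k\<close> turns 16 / k into 128 / r.\<close>

lemma sum_rich_lines_squared_le:
  fixes r :: real
  assumes fin: "finite X" "finite Y" "finite L"
    and m: "\<And>l. l \<in> L \<Longrightarrow> fst l \<noteq> 0"
    and rich: "\<And>l. l \<in> L \<Longrightarrow> r \<le> real (card (line_points X Y l))" and r: "r \<ge> 4"
  shows "(\<Sum>l\<in>L. real (card (line_points X Y l)) ^ 2) \<le> 128 * (real (card X) * real (card Y)) ^ 2 / r"
proof (cases "L = {}")
  case True
  then show ?thesis using r by simp
next
  case False
  then obtain l0 where l0: "l0 \<in> L" by auto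
  define k where "k = nat \<lfloor>r / 4\<rfloor>"
  have k1: "real k \<le> r / 4" "r / 4 < real k + 1" "k \<ge> 1"
    using r unfolding k_def by linarith+
  have k8: "r / 8 \<le> real k" using k1 by linarith
  have kc: "k \<le> card X" "k \<le> card Y"
    using rich[OF l0] card_line_points_le[OF fin(1,2) m[OF l0]] k1 r by linarith+
  let ?D = "\<lambda>l. {(x, x'). x \<in> line_points X Y l \<and> x' \<in> line_points X Y l \<and> x \<noteq> x' \<and>
       interval_index X k x = interval_index X k x' \<and>
       interval_index Y k (fst l * x + snd l) = interval_index Y k (fst l * x' + snd l)}"
  let ?CX = "{(x, x'). x \<in> X \<and> x' \<in> X \<and> interval_index X k x = interval_index X k x'}"
  let ?CY = "{(x, x'). x \<in> Y \<and> x' \<in> Y \<and> interval_index Y k x = interval_index Y k x'}"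
  have finC: "finite ?CX" "finite ?CY"
    by (rule finite_subset[of _ "X \<times> X"], use fin in auto)
       (rule finite_subset[of _ "Y \<times> Y"], use fin in auto)
  have finD: "finite (?D l)" for l
    by (rule finite_subset[of _ "X \<times> X"]) (use fin in \<open>auto simp: line_points_def\<close>)
  define F where "F = (\<lambda>(l::real\<times>real, x::real, x'::real). ((x, x'), (fst l * x + snd l, fst l * x' + snd l)))"
  have "inj_on F (Sigma L ?D)"
  proof (rule inj_onI)
    fix p q assume pq: "p \<in> Sigma L ?D" "q \<in> Sigma L ?D" "F p = F q"
    obtain m1 b1 x x' where p: "p = ((m1, b1), x, x')" by (metis prod.collapse)
    obtain m2 b2 z z' where q: "q = ((m2, b2), z, z')" by (metis prod.collapse)
    have *: "x \<noteq> x'" "F ((m1, b1), x, x') = F ((m2, b2), z, z')"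
      using pq unfolding p q by auto
    then have eq: "x = z" "x' = z'" "m1 * x + b1 = m2 * x + b2" "m1 * x' + b1 = m2 * x' + b2"
      by (auto simp: F_def)
    then have "(m1 - m2) * (x - x') = 0" by (simp add: algebra_simps)
    then have "m1 = m2" using * by simp
    then show "p = q" using eq p q by auto
  qed
  moreover have "F ` Sigma L ?D \<subseteq> ?CX \<times> ?CY"
    by (auto simp: F_def line_points_def)
  ultimately have "card (Sigma L ?D) \<le> card (?CX \<times> ?CY)"
    by (rule card_inj_on_le) (use finC in auto)
  then have "(\<Sum>l\<in>L. card (?D l)) \<le> card ?CX * card ?CY"
    using fin finD by (simp add: card_cartesian_product)
  then have "real (\<Sum>l\<in>L. card (?D l)) \<le> real (card ?CX * card ?CY)"
    by (rule of_nat_mono)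
  also have "\<dots> = real (card ?CX) * real (card ?CY)" by (rule of_nat_mult)
  also have "\<dots> \<le> (2 * real (card X) ^ 2 / real k) * (2 * real (card Y) ^ 2 / real k)"
    by (intro mult_mono card_same_interval_pairs) (use fin k1 kc in auto)
  finally have up: "(\<Sum>l\<in>L. real (card (?D l))) \<le> 4 * (real (card X) * real (card Y)) ^ 2 / real k ^ 2"
    by (simp add: power2_eq_square mult_ac)
  have "(\<Sum>l\<in>L. real (card (line_points X Y l)) ^ 2 / (4 * real k)) \<le> (\<Sum>l\<in>L. real (card (?D l)))"
  proof (rule sum_mono, rule line_same_cell_pairs)
    fix l assume l: "l \<in> L"
    have "4 * real k \<le> real (card (line_points X Y l))" using rich[OF l] k1 by linarith
    then show "4 * k \<le> card (line_points X Y l)" by linarith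
  qed (use fin m k1 in auto)
  then have "(\<Sum>l\<in>L. real (card (line_points X Y l)) ^ 2) / (4 * real k)
      \<le> 4 * (real (card X) * real (card Y)) ^ 2 / real k ^ 2"
    using up by (simp add: sum_divide_distrib)
  then have "(\<Sum>l\<in>L. real (card (line_points X Y l)) ^ 2) \<le> 16 * (real (card X) * real (card Y)) ^ 2 / real k"
    using k1 by (simp add: field_simps power2_eq_square)
  also have "\<dots> \<le> 16 * (real (card X) * real (card Y)) ^ 2 / (r / 8)"
    using k8 r by (intro divide_left_mono) auto
  finally show ?thesis by simp
qed

text \<open>The Szemeredi--Trotter bound for Cartesian products, in the range where its main term dominates.\<close>

lemma incidences_cubed_le:
  fixes I :: real
  assumes fin: "finite X" "finite Y" "finite L" and m: "\<And>l. l \<in> L \<Longrightarrow> fst l \<noteq> 0"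
    and I: "I \<le> (\<Sum>l\<in>L. real (card (line_points X Y l)))" "8 * real (card L) \<le> I" and L: "L \<noteq> {}"
  shows "I ^ 3 \<le> 1024 * (real (card X) * real (card Y) * real (card L)) ^ 2"
proof -
  let ?k = "\<lambda>l. real (card (line_points X Y l))"
  \<comment> \<open>Half of the average richness: lines with fewer than \<open>r\<close> points
    carry at most \<open>I / 2\<close> incidences, so the \<open>r\<close>-rich ones carry the rest.
    The hypothesis \<open>8 * real (card L) \<le> I\<close> says exactly that
    \<open>r \<ge> 4\<close>.\<close>
  define r where "r = I / (2 * real (card L))"
  have cL: "real (card L) > 0" using L fin by (simp add: card_gt_0_iff)
  have I0: "I > 0" using I(2) cL by linarith
  have r4: "r \<ge> 4" using I(2) cL unfolding r_def by (simp add: field_simps)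
  let ?R = "{l\<in>L. r \<le> ?k l}"
  have "(\<Sum>l\<in>L. ?k l) \<le> (\<Sum>l\<in>L. r + (if r \<le> ?k l then ?k l else 0))"
    using r4 by (intro sum_mono) auto
  also have "\<dots> = r * real (card L) + (\<Sum>l\<in>?R. ?k l)"
    using fin by (simp add: sum.distrib sum.inter_filter)
  also have "r * real (card L) = I / 2" using cL unfolding r_def by simp
  finally have "I / 2 \<le> (\<Sum>l\<in>?R. ?k l)" using I(1) by linarith
  then have "r * (I / 2) \<le> r * (\<Sum>l\<in>?R. ?k l)"
    using r4 by (intro mult_left_mono) auto
  also have "\<dots> = (\<Sum>l\<in>?R. r * ?k l)" by (rule sum_distrib_left)
  also have "\<dots> \<le> (\<Sum>l\<in>?R. ?k l ^ 2)"
    by (intro sum_mono) (auto simp: power2_eq_square mult_right_mono)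
  also have "\<dots> \<le> 128 * (real (card X) * real (card Y)) ^ 2 / r"
    by (rule sum_rich_lines_squared_le) (use fin m r4 in auto)
  finally have "r ^ 2 * I \<le> 256 * (real (card X) * real (card Y)) ^ 2"
    using r4 by (simp add: field_simps power2_eq_square)
  then have "I ^ 3 / (4 * real (card L) ^ 2) \<le> 256 * (real (card X) * real (card Y)) ^ 2"
    unfolding r_def by (simp add: power_divide power_mult_distrib power3_eq_cube power2_eq_square)
  then show ?thesis using cL by (simp add: field_simps power_mult_distrib)
qed

subsection \<open>Multiplicative energy\<close>

text \<open>A dyadic block of indices has at most 2^k terms, each at most 1 / 2^k, so it adds at
  most 1. This is the logarithm lost when the energy is summed over all richness levels.\<close>

lemma sum_inverse_le_of_less_two_power:
  "m < 2 ^ k \<Longrightarrow> (\<Sum>j = 1..m. 1 / real j) \<le> real k"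
proof (induction k arbitrary: m)
  case 0
  then show ?case by simp
next
  case (Suc k)
  let ?h = "2 ^ k - 1 :: nat"
  have h: "?h < 2 ^ k" by simp
  show ?case
  proof (cases "m < 2 ^ k")
    case True
    then show ?thesis using Suc.IH[of m] by simp
  next
    case False
    have "0 < x" if "2 ^ k \<le> x" for x :: nat
      by (rule less_le_trans[OF _ that]) simp
    with False have "{1..m} = {1..?h} \<union> {2 ^ k..m}"
      by (auto simp: Suc_le_eq)
    then have "(\<Sum>j = 1..m. 1 / real j) = (\<Sum>j\<in>{1..?h}. 1 / real j) + (\<Sum>j\<in>{2 ^ k..m}. 1 / real j)"
      by (simp only:) (rule sum.union_disjoint, use h in auto)
    also have "(\<Sum>j\<in>{2 ^ k..m}. 1 / real j) \<le> (\<Sum>j\<in>{2 ^ k..m}. 1 / 2 ^ k)"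
    proof (intro sum_mono divide_left_mono)
      fix j assume "j \<in> {2 ^ k..m}"
      then have "2 ^ k \<le> j" by simp
      then have "real (2 ^ k) \<le> real j" by (rule of_nat_mono)
      then show "2 ^ k \<le> real j" by simp
      then show "0 < real j * 2 ^ k" by (intro mult_pos_pos) (auto intro: less_le_trans[of 0 "2 ^ k"])
    qed auto
    also have "\<dots> = real (card {2 ^ k..m}) / 2 ^ k" by simp
    also have "\<dots> \<le> 1"
    proof -
      have "card {2 ^ k..m} \<le> 2 ^ k" using Suc.prems by simp
      then have "real (card {2 ^ k..m}) \<le> real (2 ^ k)" by (rule of_nat_mono)
      then show ?thesis by simp
    qed
    finally show ?thesis using Suc.IH[OF h] by simp
  qed
qed

text \<open>The linear relation lets every point \<open>(p, m p)\<close> of a ray be moved, from a base point in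
  \<open>c\<^sub>2 P\<^sub>2 \<times> - c\<^sub>2 P\<^sub>2\<close>, into the grid \<open>c\<^sub>3 P\<^sub>3 \<times> c\<^sub>1 P\<^sub>1\<close> in at least \<open>d\<^sup>2\<close> ways;
  so a rich ray produces many rich lines parallel to it (an argument of Elekes and Ruzsa).\<close>

lemma card_rich_slopes_le:
  fixes P1 P2 P3 R1 R3 M :: "real set" and c1 c2 c3 t d s :: real
  assumes fin: "finite P1" "finite P2" "finite P3" "finite M"
    and c: "c1 \<noteq> 0" "c2 \<noteq> 0" "c3 \<noteq> 0"
    and t: "real (card P1) \<le> t" "real (card P2) \<le> t" "real (card P3) \<le> t"
    and sub: "R1 \<subseteq> P1" "R3 \<subseteq> P3"
    and d1: "\<And>p. p \<in> R1 \<Longrightarrow> d \<le> real (card {q\<in>P2. (c1 * p + c2 * q) / c3 \<in> P3})"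
    and d3: "\<And>p. p \<in> R3 \<Longrightarrow> d \<le> real (card {q\<in>P2. (c3 * p - c2 * q) / c1 \<in> P1})"
    and d: "d > 0" and tp: "t > 0"
    and M: "\<And>m. m \<in> M \<Longrightarrow> m \<noteq> 0" "\<And>m. m \<in> M \<Longrightarrow> s \<le> real (card {p\<in>R1. m * p \<in> R3})"
    and s: "8 * t ^ 2 / d ^ 2 \<le> s"
  shows "real (card M) \<le> 1024 * t ^ 6 / (s ^ 2 * d ^ 4)"
proof -
  have finR: "finite R1" "finite R3" using fin sub finite_subset by auto
  define X where "X = (*) c3 ` P3"
  define Y where "Y = (*) c1 ` P1"
  define X' where "X' = (*) c2 ` P2"
  define Y' where "Y' = (*) (- c2) ` P2"
  have cX: "card X = card P3" "card Y = card P1" "card X' = card P2" "card Y' = card P2"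
    unfolding X_def Y_def X'_def Y'_def using c by (auto intro!: card_image inj_onI)
  have finX: "finite X" "finite Y" "finite X'" "finite Y'"
    unfolding X_def Y_def X'_def Y'_def using fin by auto
  \<comment> \<open>The line of \<open>(m, q, q')\<close> is the image of the ray
    \<open>y = m x\<close> under \<open>(x, y) \<mapsto> (c1 x + c2 q, c3 y - c2 q')\<close>, so it
    passes through the base point \<open>(c2 q, - c2 q')\<close>. \<open>C\<close> collects the
    points of the ray that land in the grid \<open>X \<times> Y\<close>.\<close>
  define line where "line = (\<lambda>(m, q, q'). (c3 * m / c1, - (c3 * m / c1) * (c2 * q) - c2 * q' :: real))"
  define C where "C = (\<lambda>(m, q, q'). {p\<in>R1. m * p \<in> R3 \<and> (c1 * p + c2 * q) / c3 \<in> P3 \<and> (c3 * (m * p) - c2 * q') / c1 \<in> P1})"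
  have finC: "finite (C x)" for x unfolding C_def using finR by (auto split: prod.split)
  have cnt: "card (C x) \<le> card (line_points X Y (line x))" for x
  proof -
    obtain m q q' where x: "x = (m, q, q')" by (metis prod.collapse)
    have "inj_on (\<lambda>p. c1 * p + c2 * q) (C x)" using c by (auto intro!: inj_onI)
    moreover have "(\<lambda>p. c1 * p + c2 * q) ` C x \<subseteq> line_points X Y (line x)"
    proof
      fix z assume "z \<in> (\<lambda>p. c1 * p + c2 * q) ` C x"
      then obtain p where p: "z = c1 * p + c2 * q" "(c1 * p + c2 * q) / c3 \<in> P3" "(c3 * (m * p) - c2 * q') / c1 \<in> P1"
        unfolding C_def x by auto
      have "z \<in> X" unfolding X_def using p c by (auto intro!: image_eqI[of _ _ "(c1 * p + c2 * q) / c3"])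
      moreover have "fst (line x) * z + snd (line x) = c3 * (m * p) - c2 * q'"
        unfolding line_def x p(1) using c by (simp add: field_simps)
      moreover have "c3 * (m * p) - c2 * q' \<in> Y" unfolding Y_def using p c
        by (auto intro!: image_eqI[of _ _ "(c3 * (m * p) - c2 * q') / c1"])
      ultimately show "z \<in> line_points X Y (line x)" unfolding line_points_def by simp
    qed
    ultimately show ?thesis by (rule card_inj_on_le) (use finX in auto)
  qed
  have s0: "s > 0" using s d tp by (smt (verit) divide_pos_pos zero_less_power)
  \<comment> \<open>For each slope the shifts contribute at least s d^2 points in total
    (\<open>tot\<close>), spread over at most t^2 base points; \<open>r\<close> is half of that
    average. The hypothesis on \<open>s\<close> amounts to \<open>r \<ge> 4\<close>.\<close>
  define r where "r = s * d ^ 2 / (2 * t ^ 2)"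
  have r4: "r \<ge> 4" using s d tp unfolding r_def by (simp add: field_simps)
  have tot: "s * d ^ 2 \<le> (\<Sum>b\<in>P2 \<times> P2. real (card (C (m, b))))" if m: "m \<in> M" for m
  proof -
    let ?ray = "{p\<in>R1. m * p \<in> R3}"
    let ?E = "\<lambda>p. {q\<in>P2. (c1 * p + c2 * q) / c3 \<in> P3} \<times> {q\<in>P2. (c3 * (m * p) - c2 * q) / c1 \<in> P1}"
    have "s * d ^ 2 \<le> real (card ?ray) * d ^ 2" using M(2)[OF m] by (intro mult_right_mono) auto
    also have "\<dots> = (\<Sum>p\<in>?ray. d * d)" by (simp add: power2_eq_square)
    also have "\<dots> \<le> (\<Sum>p\<in>?ray. real (card (?E p)))"
    proof (rule sum_mono)
      fix p assume "p \<in> ?ray"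
      then show "d * d \<le> real (card (?E p))"
        unfolding card_cartesian_product of_nat_mult using d1[of p] d3[of "m * p"] d
        by (intro mult_mono) auto
    qed
    also have "\<dots> = real (\<Sum>p\<in>?ray. card {b\<in>P2 \<times> P2. p \<in> C (m, b)})"
    proof -
      have "?E p = {b\<in>P2 \<times> P2. p \<in> C (m, b)}" if "p \<in> ?ray" for p
        using that unfolding C_def by auto
      then show ?thesis by simp
    qed
    also have "(\<Sum>p\<in>?ray. card {b\<in>P2 \<times> P2. p \<in> C (m, b)}) = (\<Sum>b\<in>P2 \<times> P2. card (C (m, b)))"
      by (rule sum_multicount_gen) (use finR fin in \<open>auto simp: C_def intro!: arg_cong[of _ _ card]\<close>)
    finally show ?thesis by simp
  qed
  define T where "T = {x \<in> M \<times> P2 \<times> P2. r \<le> real (card (C x))}"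
  have finT: "finite T" unfolding T_def using fin by auto
  have "real (card M) * (s * d ^ 2) \<le> (\<Sum>m\<in>M. \<Sum>b\<in>P2 \<times> P2. real (card (C (m, b))))"
    using sum_mono[OF tot] by simp
  also have "\<dots> = (\<Sum>x\<in>M \<times> P2 \<times> P2. real (card (C x)))"
    by (simp add: sum.cartesian_product split_def)
  also have "\<dots> \<le> (\<Sum>x\<in>M \<times> P2 \<times> P2. r + (if r \<le> real (card (C x)) then real (card (C x)) else 0))"
    using r4 by (intro sum_mono) auto
  also have "\<dots> = r * (real (card M) * (real (card P2) * real (card P2))) + (\<Sum>x\<in>T. real (card (C x)))"
    unfolding T_def using fin by (simp add: sum.distrib sum.inter_filter card_cartesian_product)
  also have "r * (real (card M) * (real (card P2) * real (card P2))) \<le> r * (real (card M) * (t * t))"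
    using t(2) r4 tp by (intro mult_left_mono mult_mono) auto
  also have "r * (real (card M) * (t * t)) = real (card M) * (s * d ^ 2) / 2"
    unfolding r_def using tp by (simp add: field_simps power2_eq_square)
  finally have lower: "real (card M) * (s * d ^ 2) / 2 \<le> (\<Sum>x\<in>T. real (card (C x)))" by linarith
  let ?L = "line ` T"
  let ?k = "\<lambda>l. real (card (line_points X Y l))" and ?b = "\<lambda>l. real (card (line_points X' Y' l))"
  have "(\<Sum>x\<in>T. real (card (C x))) \<le> (\<Sum>x\<in>T. ?k (line x))"
    using cnt by (intro sum_mono) auto
  \<comment> \<open>Several triples may give the same line \<open>l\<close>. Since \<open>l\<close>
    and \<open>q\<close> determine \<open>m\<close> and \<open>q'\<close>, their number is at most
    the number \<open>?b l\<close> of base points on \<open>l\<close>.\<close>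
  also have "\<dots> = (\<Sum>l\<in>?L. real (card {x\<in>T. line x = l}) * ?k l)"
    by (rule sum_fun_comp) (use finT in auto)
  also have "\<dots> \<le> (\<Sum>l\<in>?L. ?b l * ?k l)"
  proof (intro sum_mono mult_right_mono)
    fix l assume "l \<in> ?L"
    have "inj_on (\<lambda>(m, q, q'). c2 * q) {x\<in>T. line x = l}"
    proof (rule inj_onI)
      fix x y assume xy: "x \<in> {x\<in>T. line x = l}" "y \<in> {x\<in>T. line x = l}"
        "(case x of (m, q, q') \<Rightarrow> c2 * q) = (case y of (m, q, q') \<Rightarrow> c2 * q)"
      obtain m q q' n u u' where *: "x = (m, q, q')" "y = (n, u, u')" by (metis prod.collapse)
      have e: "line x = line y" using xy by auto
      have q: "q = u" using xy(3) c * by simp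
      have m: "m = n" using e c unfolding * line_def by simp
      have "q' = u'" using e c unfolding * line_def m q by simp
      then show "x = y" using * q m by simp
    qed
    moreover have "(\<lambda>(m, q, q'). c2 * q) ` {x\<in>T. line x = l} \<subseteq> line_points X' Y' l"
      unfolding T_def line_points_def X'_def Y'_def line_def by (auto simp: algebra_simps)
    ultimately have "card {x\<in>T. line x = l} \<le> card (line_points X' Y' l)"
      by (rule card_inj_on_le) (use finX in auto)
    then show "real (card {x\<in>T. line x = l}) \<le> ?b l" by simp
  qed auto
  \<comment> \<open>Every line here has \<open>r \<le> ?k l\<close>, so if \<open>?b l\<close> is
    the larger factor it is at least \<open>r\<close> as well. Both sums of squares thus run over
    rich lines only.\<close>
  also have "\<dots> \<le> (\<Sum>l\<in>?L. ?k l ^ 2 + (if r \<le> ?b l then ?b l ^ 2 else 0))"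
  proof (rule sum_mono)
    fix l assume "l \<in> ?L"
    then obtain x where x: "x \<in> T" "l = line x" by auto
    then have rk: "r \<le> ?k l" using cnt[of x] unfolding T_def by auto
    show "?b l * ?k l \<le> ?k l ^ 2 + (if r \<le> ?b l then ?b l ^ 2 else 0)"
    proof (cases "?b l \<le> ?k l")
      case True
      then have "?b l * ?k l \<le> ?k l ^ 2" by (simp add: power2_eq_square mult_right_mono)
      then show ?thesis by (smt (verit) zero_le_power2)
    next
      case False
      then have "?b l * ?k l \<le> ?b l ^ 2" by (simp add: power2_eq_square mult_left_mono)
      then show ?thesis using False rk by (smt (verit) zero_le_power2)
    qed
  qed
  also have "\<dots> = (\<Sum>l\<in>?L. ?k l ^ 2) + (\<Sum>l\<in>{l\<in>?L. r \<le> ?b l}. ?b l ^ 2)"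
    using finT by (simp add: sum.distrib sum.inter_filter)
  also have "\<dots> \<le> 128 * (t * t) ^ 2 / r + 128 * (t * t) ^ 2 / r"
  proof (rule add_mono)
    have nz: "fst l \<noteq> 0" if "l \<in> ?L" for l
      using that c M(1) unfolding line_def T_def by auto
    have rk: "r \<le> ?k l" if "l \<in> ?L" for l
    proof -
      from that obtain x where x: "x \<in> T" "l = line x" by auto
      then show ?thesis using cnt[of x] unfolding T_def by auto
    qed
    have "(\<Sum>l\<in>?L. ?k l ^ 2) \<le> 128 * (real (card X) * real (card Y)) ^ 2 / r"
      by (rule sum_rich_lines_squared_le) (use finX finT nz rk r4 in auto)
    also have "\<dots> \<le> 128 * (t * t) ^ 2 / r"
      using t tp r4 unfolding cX by (intro divide_right_mono mult_left_mono power_mono mult_mono) auto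
    finally show "(\<Sum>l\<in>?L. ?k l ^ 2) \<le> 128 * (t * t) ^ 2 / r" .
    have "(\<Sum>l\<in>{l\<in>?L. r \<le> ?b l}. ?b l ^ 2) \<le> 128 * (real (card X') * real (card Y')) ^ 2 / r"
      by (rule sum_rich_lines_squared_le) (use finX finT nz r4 in auto)
    also have "\<dots> \<le> 128 * (t * t) ^ 2 / r"
      using t tp r4 unfolding cX by (intro divide_right_mono mult_left_mono power_mono mult_mono) auto
    finally show "(\<Sum>l\<in>{l\<in>?L. r \<le> ?b l}. ?b l ^ 2) \<le> 128 * (t * t) ^ 2 / r" .
  qed
  finally have "real (card M) * (s * d ^ 2) / 2 \<le> 256 * (t * t) ^ 2 / r" using lower by simp
  also have "\<dots> = 512 * t ^ 6 / (s * d ^ 2)"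
    unfolding r_def using tp d s0 by (simp add: field_simps power_numeral_reduce)
  finally have "real (card M) * (s * d ^ 2) * (s * d ^ 2) \<le> 1024 * t ^ 6"
    using s0 d by (simp add: field_simps)
  then show ?thesis using s0 d
    by (simp add: pos_le_divide_eq power_numeral_reduce mult_ac)
qed

text \<open>Let N(m) count the pairs in \<open>R1 \<times> R3\<close> of ratio m. The energy, the
  sum of N(m)^2, is at most the sum over j of 2 j times the number of m with N(m) >= j. For j up to
  8 t^2 / d^2 only the trivial sum of N(m), at most t^2, is used; beyond that
  \<open>card_rich_slopes_le\<close> leaves a harmonic sum. Because d <= t the trivial range is
  dominated as well: 2064 = 2048 + 16.\<close>

lemma multiplicative_energy_le:
  fixes P1 P2 P3 R1 R3 :: "real set" and c1 c2 c3 t d :: real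
  assumes fin: "finite P1" "finite P2" "finite P3"
    and c: "c1 \<noteq> 0" "c2 \<noteq> 0" "c3 \<noteq> 0"
    and t: "real (card P1) \<le> t" "real (card P2) \<le> t" "real (card P3) \<le> t"
    and sub: "R1 \<subseteq> P1" "R3 \<subseteq> P3"
    and pos: "\<And>p. p \<in> R1 \<Longrightarrow> p > 0" "\<And>p. p \<in> R3 \<Longrightarrow> p > 0"
    and d1: "\<And>p. p \<in> R1 \<Longrightarrow> d \<le> real (card {q\<in>P2. (c1 * p + c2 * q) / c3 \<in> P3})"
    and d3: "\<And>p. p \<in> R3 \<Longrightarrow> d \<le> real (card {q\<in>P2. (c3 * p - c2 * q) / c1 \<in> P1})"
    and d: "d > 0" and tk: "t < 2 ^ k" and tp: "t \<ge> 1"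
  shows "real (card {(x, x'). x \<in> R1 \<times> R3 \<and> x' \<in> R1 \<times> R3 \<and> snd x / fst x = snd x' / fst x'})
    \<le> 2064 * real k * t ^ 6 / d ^ 4"
proof (cases "R1 = {}")
  case True
  then show ?thesis using tp by simp
next
  case False
  have finR: "finite R1" "finite R3" using fin sub finite_subset by auto
  have dt: "d \<le> t"
  proof -
    from False obtain p where "p \<in> R1" by auto
    then have "d \<le> real (card {q\<in>P2. (c1 * p + c2 * q) / c3 \<in> P3})" by (rule d1)
    also have "\<dots> \<le> real (card P2)" using fin by (intro of_nat_mono card_mono) auto
    finally show ?thesis using t(2) by simp
  qed
  define f where "f = (\<lambda>x::real\<times>real. snd x / fst x)"
  define M where "M = f ` (R1 \<times> R3)"
  define N where "N m = card {x\<in>R1 \<times> R3. f x = m}" for m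
  define T where "T = card P1"
  have finM: "finite M" unfolding M_def using finR by auto
  have M0: "m \<noteq> 0" if "m \<in> M" for m
    using that pos unfolding M_def f_def by force
  have ray: "N m = card {p\<in>R1. m * p \<in> R3}" for m
  proof -
    have "{x\<in>R1 \<times> R3. f x = m} = (\<lambda>p. (p, m * p)) ` {p\<in>R1. m * p \<in> R3}"
    proof (rule set_eqI, rule iffI)
      fix x assume x: "x \<in> {x\<in>R1 \<times> R3. f x = m}"
      then have "snd x = m * fst x" using pos(1)[of "fst x"] unfolding f_def by auto
      then show "x \<in> (\<lambda>p. (p, m * p)) ` {p\<in>R1. m * p \<in> R3}"
        using x by (intro image_eqI[of _ _ "fst x"]) (auto simp: prod_eq_iff)
    next
      fix x assume "x \<in> (\<lambda>p. (p, m * p)) ` {p\<in>R1. m * p \<in> R3}"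
      then obtain p where "x = (p, m * p)" "p \<in> R1" "m * p \<in> R3" by auto
      then show "x \<in> {x\<in>R1 \<times> R3. f x = m}" using pos(1)[of p] unfolding f_def by simp
    qed
    then show ?thesis unfolding N_def by (simp add: card_image inj_on_def)
  qed
  have NT: "N m \<le> T" for m
  proof -
    have "N m \<le> card R1" unfolding ray using finR by (intro card_mono) auto
    also have "\<dots> \<le> T" unfolding T_def using fin sub by (intro card_mono) auto
    finally show ?thesis .
  qed
  have "(\<Sum>m\<in>M. N m) = card (R1 \<times> R3)"
    unfolding N_def by (rule card_eq_sum_fibres[symmetric]) (use finR finM in \<open>auto simp: M_def\<close>)
  also have "\<dots> = card R1 * card R3" by (rule card_cartesian_product)
  also have "\<dots> \<le> card P1 * card P3" using fin sub by (intro mult_mono card_mono) auto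
  finally have "real (\<Sum>m\<in>M. N m) \<le> real (card P1 * card P3)" by (rule of_nat_mono)
  also have "\<dots> = real (card P1) * real (card P3)" by (rule of_nat_mult)
  also have "\<dots> \<le> t * t" using t tp by (intro mult_mono) auto
  finally have sumN: "(\<Sum>m\<in>M. real (N m)) \<le> t ^ 2" by (simp add: power2_eq_square)
  have Mj: "(\<Sum>j = 1..T. real (card {m\<in>M. j \<le> N m})) = (\<Sum>m\<in>M. real (N m))"
  proof -
    have "(\<Sum>j = 1..T. card {m\<in>M. j \<le> N m}) = (\<Sum>m\<in>M. N m)"
    proof (rule sum_multicount_gen)
      show "\<forall>m\<in>M. card {j \<in> {1..T}. j \<le> N m} = N m"
      proof
        fix m
        have "{j \<in> {1..T}. j \<le> N m} = {1..N m}" using NT[of m] by auto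
        then show "card {j \<in> {1..T}. j \<le> N m} = N m" by simp
      qed
    qed (use finM in auto)
    then show ?thesis by (simp only: of_nat_sum[symmetric])
  qed
  have "real (card {(x, x'). x \<in> R1 \<times> R3 \<and> x' \<in> R1 \<times> R3 \<and> f x = f x'}) = (\<Sum>m\<in>M. real (N m) ^ 2)"
    using card_collisions_eq_sum[of "R1 \<times> R3" M f] finR finM unfolding N_def M_def by simp
  also have "\<dots> \<le> (\<Sum>m\<in>M. \<Sum>j = 1..T. if j \<le> N m then 2 * real j else 0)"
  proof (rule sum_mono)
    fix m
    have "(\<Sum>j = 1..T. if j \<le> N m then 2 * real j else 0) = (\<Sum>j\<in>{j\<in>{1..T}. j \<le> N m}. 2 * real j)"
      by (rule sum.inter_filter[symmetric]) simp
    also have "{j\<in>{1..T}. j \<le> N m} = {1..N m}" using NT[of m] by auto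
    also have "(\<Sum>j = 1..N m. 2 * real j) = real (N m) * (real (N m) + 1)"
    proof -
      have "(\<Sum>j = 1..q. 2 * real j) = real q * (real q + 1)" for q
        by (induction q) (auto simp: algebra_simps)
      then show ?thesis .
    qed
    finally show "real (N m) ^ 2 \<le> (\<Sum>j = 1..T. if j \<le> N m then 2 * real j else 0)"
      by (simp add: power2_eq_square algebra_simps)
  qed
  also have "\<dots> = (\<Sum>j = 1..T. \<Sum>m\<in>M. if j \<le> N m then 2 * real j else 0)" by (rule sum.swap)
  also have "\<dots> = (\<Sum>j = 1..T. 2 * real j * real (card {m\<in>M. j \<le> N m}))"
    using finM by (intro sum.cong) (auto simp: sum.inter_filter[symmetric])
  also have "\<dots> \<le> (\<Sum>j = 1..T. 16 * t ^ 2 / d ^ 2 * real (card {m\<in>M. j \<le> N m}) + 2048 * t ^ 6 / d ^ 4 * (1 / real j))"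
  proof (rule sum_mono)
    fix j assume j: "j \<in> {1..T}"
    show "2 * real j * real (card {m\<in>M. j \<le> N m}) \<le>
      16 * t ^ 2 / d ^ 2 * real (card {m\<in>M. j \<le> N m}) + 2048 * t ^ 6 / d ^ 4 * (1 / real j)"
    proof (cases "real j \<le> 8 * t ^ 2 / d ^ 2")
      case True
      then have "2 * real j \<le> 16 * t ^ 2 / d ^ 2" by simp
      then have "2 * real j * real (card {m\<in>M. j \<le> N m}) \<le> 16 * t ^ 2 / d ^ 2 * real (card {m\<in>M. j \<le> N m})"
        by (rule mult_right_mono) simp
      moreover have "0 \<le> 2048 * t ^ 6 / d ^ 4 * (1 / real j)" using tp d by simp
      ultimately show ?thesis by linarith
    next
      case False
      have "real (card {m\<in>M. j \<le> N m}) \<le> 1024 * t ^ 6 / (real j ^ 2 * d ^ 4)"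
      proof (rule card_rich_slopes_le[OF fin(1-3) _ c t sub d1 d3 d])
        show "real j \<le> real (card {p\<in>R1. m * p \<in> R3})" if "m \<in> {m\<in>M. j \<le> N m}" for m
          using that by (simp add: ray)
        show "m \<noteq> 0" if "m \<in> {m\<in>M. j \<le> N m}" for m
          using that M0 by blast
      qed (use finM tp False in auto)
      then have "2 * real j * real (card {m\<in>M. j \<le> N m}) \<le> 2 * real j * (1024 * t ^ 6 / (real j ^ 2 * d ^ 4))"
        by (rule mult_left_mono) simp
      also have "\<dots> = 2048 * t ^ 6 / d ^ 4 * (1 / real j)"
        using j by (simp add: power2_eq_square)
      moreover have "0 \<le> 16 * t ^ 2 / d ^ 2 * real (card {m\<in>M. j \<le> N m})" by simp
      ultimately show ?thesis by linarith
    qed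
  qed
  also have "\<dots> = 16 * t ^ 2 / d ^ 2 * (\<Sum>m\<in>M. real (N m)) + 2048 * t ^ 6 / d ^ 4 * (\<Sum>j = 1..T. 1 / real j)"
    by (simp only: sum.distrib sum_distrib_left[symmetric] Mj)
  also have "\<dots> \<le> 16 * t ^ 2 / d ^ 2 * t ^ 2 + 2048 * t ^ 6 / d ^ 4 * real k"
  proof (intro add_mono mult_left_mono sumN)
    have "real T < 2 ^ k" using t(1) tk unfolding T_def by linarith
    then have "T < 2 ^ k" by simp
    then show "(\<Sum>j = 1..T. 1 / real j) \<le> real k" by (rule sum_inverse_le_of_less_two_power)
  qed (use tp d in auto)
  also have "16 * t ^ 2 / d ^ 2 * t ^ 2 \<le> 16 * t ^ 6 / d ^ 4 * real k"
  proof -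
    have "k \<noteq> 0" using tp tk by (intro notI) simp
    then have k1: "real k \<ge> 1" by simp
    have "16 * t ^ 2 / d ^ 2 * t ^ 2 * d ^ 4 = 16 * t ^ 4 * d ^ 2"
      using d by (simp add: power_numeral_reduce)
    also have "\<dots> \<le> 16 * t ^ 4 * t ^ 2" using dt d by (intro mult_left_mono power_mono) auto
    also have "\<dots> \<le> 16 * t ^ 4 * t ^ 2 * real k" using k1 tp by simp
    finally show ?thesis using d by (simp add: field_simps power_numeral_reduce)
  qed
  finally show ?thesis unfolding f_def by (simp add: field_simps)
qed

subsection \<open>Regular products\<close>

lemma dyadic_level_exists:
  fixes x :: nat
  shows "1 \<le> x \<Longrightarrow> x < 2 ^ k \<Longrightarrow> \<exists>j<k. 2 ^ j \<le> x \<and> x < 2 ^ (j + 1)"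
proof (induction k)
  case (Suc k)
  show ?case
  proof (cases "x < 2 ^ k")
    case True
    then show ?thesis using Suc by (metis less_Suc_eq)
  next
    case False
    then show ?thesis using Suc.prems by (intro exI[of _ k]) auto
  qed
qed simp

lemma dyadic_pigeonhole:
  fixes g :: "'a \<Rightarrow> nat" and w :: "'a \<Rightarrow> real"
  assumes "finite X" "k > 0" "\<And>x. x \<in> X \<Longrightarrow> 1 \<le> g x \<and> g x < 2 ^ k" "\<And>x. x \<in> X \<Longrightarrow> 0 \<le> w x"
  obtains j where "(\<Sum>x\<in>X. w x) \<le> real k * (\<Sum>x\<in>{x\<in>X. 2 ^ j \<le> g x \<and> g x < 2 ^ (j + 1)}. w x)"
proof -
  let ?L = "\<lambda>j. {x\<in>X. 2 ^ j \<le> g x \<and> g x < 2 ^ (j + 1)}"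
  have "\<forall>x\<in>X. \<exists>j. j < k \<and> 2 ^ j \<le> g x \<and> g x < 2 ^ (j + 1)"
    using dyadic_level_exists assms(3) by blast
  then obtain l where l: "\<forall>x\<in>X. l x < k \<and> 2 ^ l x \<le> g x \<and> g x < 2 ^ (l x + 1)"
    by (rule bchoice[THEN exE])
  have "(\<Sum>x\<in>X. w x) = (\<Sum>j\<in>{..<k}. \<Sum>x\<in>{x\<in>X. l x = j}. w x)"
    by (rule sum.group[symmetric]) (use assms l in auto)
  also have "\<dots> \<le> (\<Sum>j\<in>{..<k}. \<Sum>x\<in>?L j. w x)"
    by (intro sum_mono sum_mono2) (use assms l in auto)
  finally have *: "(\<Sum>x\<in>X. w x) \<le> (\<Sum>j\<in>{..<k}. \<Sum>x\<in>?L j. w x)" .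
  have "\<exists>j. (\<Sum>x\<in>X. w x) \<le> real k * (\<Sum>x\<in>?L j. w x)"
  proof (rule ccontr)
    assume "\<not> ?thesis"
    then have "real k * (\<Sum>x\<in>?L j. w x) < (\<Sum>x\<in>X. w x)" for j by (simp add: not_le)
    then have "(\<Sum>j\<in>{..<k}. real k * (\<Sum>x\<in>?L j. w x)) < (\<Sum>j\<in>{..<k}. \<Sum>x\<in>X. w x)"
      using assms(2) by (intro sum_strict_mono) auto
    then have "real k * (\<Sum>j\<in>{..<k}. \<Sum>x\<in>?L j. w x) < real k * (\<Sum>x\<in>X. w x)"
      by (simp add: sum_distrib_left)
    then show False using * assms(2) by simp
  qed
  then show thesis using that by blast
qed

text \<open>For \<open>l \<noteq> 0\<close> this is the intersection of \<open>A\<close> with its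
  dilate by 1 / l: the abscissae of the points of \<open>A \<times> A\<close> on the line of slope
  \<open>l\<close> through the origin.\<close>

definition dilation_part :: "real set \<Rightarrow> real \<Rightarrow> real set" where
  "dilation_part A l = {a \<in> A. l * a \<in> A}"

lemma finite_dilation_part [simp]: "finite A \<Longrightarrow> finite (dilation_part A l)"
  by (simp add: dilation_part_def)

lemma finite_prodset [simp]: "finite A \<Longrightarrow> finite (prodset A)"
  by (rule finite_subset[of _ "(\<lambda>(a, b). a * b) ` (A \<times> A)"]) (auto simp: prodset_def)

lemma finite_sumset [simp]: "finite A \<Longrightarrow> finite (sumset A)"
  by (rule finite_subset[of _ "(\<lambda>(a, b). a + b) ` (A \<times> A)"]) (auto simp: sumset_def)

text \<open>Products \<open>a p\<close> with \<open>p \<in> dilation_part A \<lambda>\<close> lie in \<open>A A\<close> and so do their dilates by \<open>\<lambda>\<close>.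
  After restricting to products of one dyadic multiplicity, a typical one of them occurs for
  many slopes \<open>\<mu>\<close>, however small the sets \<open>Q \<mu>\<close> are.\<close>

lemma regular_products:
  fixes A S :: "real set" and \<tau> :: real and k :: nat
  assumes finA: "finite A" and A: "A \<noteq> {}" and Apos: "\<And>a. a \<in> A \<Longrightarrow> a > 0"
    and finS: "finite S" and S: "S \<noteq> {}"
    and \<tau>: "\<tau> > 0" "\<And>l. l \<in> S \<Longrightarrow> \<tau> \<le> real (card (dilation_part A l))"
      "\<And>l. l \<in> S \<Longrightarrow> real (card (dilation_part A l)) \<le> 2 * \<tau>"
    and k: "2 * \<tau> < 2 ^ k" "k > 0"
  obtains B \<rho> :: real and Q :: "real \<Rightarrow> real set" and G :: "real \<Rightarrow> (real \<times> real) set" where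
    "B > 0" "B \<le> 4 * real k * real (card (prodset A))"
    "\<rho> = real (card S) * B / (8 * real k * real (card (prodset A)))"
    "\<And>l. l \<in> S \<Longrightarrow> finite (Q l) \<and> real (card (Q l)) \<le> B"
    "\<And>l y. l \<in> S \<Longrightarrow> y \<in> Q l \<Longrightarrow> l * y \<in> prodset A"
    "\<And>l. l \<in> S \<Longrightarrow> G l \<subseteq> A \<times> dilation_part A l"
    "\<And>l a p. l \<in> S \<Longrightarrow> (a, p) \<in> G l \<Longrightarrow> a * p \<in> Q l \<and> \<rho> \<le> real (card {m\<in>S. a * p \<in> Q m})"
    "real (card A) * \<tau> * real (card S) / (2 * real k) \<le> (\<Sum>l\<in>S. real (card (G l)))"
proof -
  define n where "n = real (card A)"
  define h where "h = real (card (prodset A))"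
  define R where "R l y = card {x \<in> A \<times> dilation_part A l. fst x * snd x = y}" for l y
  have n0: "n > 0" unfolding n_def using finA A by (simp add: card_gt_0_iff)
  have s0: "real (card S) > 0" using finS S by (simp add: card_gt_0_iff)
  have h0: "h > 0"
  proof -
    obtain a where "a \<in> A" using A by auto
    then have "a * a \<in> prodset A" unfolding prodset_def by auto
    then show ?thesis unfolding h_def using finA by (auto simp: card_gt_0_iff)
  qed
  define X where "X = (SIGMA l:S. A \<times> dilation_part A l)"
  have finX: "finite X" unfolding X_def using finS finA by auto
  define g where "g = (\<lambda>(l, x). R l (fst x * snd x))"
  have g: "1 \<le> g x \<and> g x < 2 ^ k" if "x \<in> X" for x
  proof -
    obtain l a p where x: "x = (l, a, p)" by (metis prod.collapse)
    have m: "l \<in> S" "a \<in> A" "p \<in> dilation_part A l" using that unfolding X_def x by auto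
    have "(a, p) \<in> {x \<in> A \<times> dilation_part A l. fst x * snd x = a * p}" using m by auto
    then have "R l (a * p) \<noteq> 0" unfolding R_def using finA by (subst card_0_eq) auto
    moreover have "R l (a * p) \<le> card (dilation_part A l)"
      unfolding R_def
    proof (rule card_inj_on_le[of snd])
      show "inj_on snd {x \<in> A \<times> dilation_part A l. fst x * snd x = a * p}"
      proof (rule inj_onI)
        fix x y assume xy: "x \<in> {x \<in> A \<times> dilation_part A l. fst x * snd x = a * p}"
          "y \<in> {x \<in> A \<times> dilation_part A l. fst x * snd x = a * p}" "snd x = snd y"
        then have "snd y \<in> A" unfolding dilation_part_def by auto
        then have "snd y \<noteq> 0" using Apos by force
        moreover have "fst x * snd y = fst y * snd y" using xy by auto
        ultimately have "fst x = fst y" by simp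
        then show "x = y" using xy by (auto simp: prod_eq_iff)
      qed
    qed (use finA in auto)
    then have "real (R l (a * p)) < 2 ^ k" using \<tau>(3)[OF m(1)] k(1) by linarith
    then have "R l (a * p) < 2 ^ k" by simp
    ultimately show ?thesis unfolding g_def x by simp
  qed
  \<comment> \<open>The pigeonhole runs over all triples \<open>(l, a, p)\<close> at once, so that a
    single multiplicity level \<open>r\<close> serves every slope.\<close>
  obtain j where j: "(\<Sum>x\<in>X. 1) \<le> real k * (\<Sum>x\<in>{x\<in>X. 2 ^ j \<le> g x \<and> g x < 2 ^ (j + 1)}. 1)"
    by (rule dyadic_pigeonhole[where w = "\<lambda>_. 1", OF finX k(2) g]) auto
  define r where "r = (2 ^ j :: real)"
  have r0: "r > 0" unfolding r_def by simp
  define G0 where "G0 l = {x \<in> A \<times> dilation_part A l. r \<le> real (R l (fst x * snd x)) \<and> real (R l (fst x * snd x)) < 2 * r}" for l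
  define Q where "Q l = (\<lambda>x. fst x * snd x) ` G0 l" for l
  have finG0: "finite (G0 l)" for l unfolding G0_def using finA by auto
  have finQ: "finite (Q l)" for l unfolding Q_def using finG0 by auto
  have QR: "r \<le> real (R l y) \<and> real (R l y) < 2 * r" if "y \<in> Q l" for l y
    using that unfolding Q_def G0_def by auto
  have QH: "y \<in> prodset A" "l * y \<in> prodset A" if "y \<in> Q l" for l y
  proof -
    from that obtain a p where ap: "a \<in> A" "p \<in> A" "l * p \<in> A" "y = a * p"
      unfolding Q_def G0_def dilation_part_def by auto
    then show "y \<in> prodset A" unfolding prodset_def by auto
    have "l * y = a * (l * p)" using ap by simp
    then show "l * y \<in> prodset A" unfolding prodset_def using ap by blast
  qed
  have fib: "{x\<in>G0 l. fst x * snd x = y} = {x \<in> A \<times> dilation_part A l. fst x * snd x = y}" if "y \<in> Q l" for l y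
    using QR[OF that] unfolding G0_def by auto
  have cG0: "real (card (G0 l)) = (\<Sum>y\<in>Q l. real (R l y))" for l
  proof -
    have "card (G0 l) = (\<Sum>y\<in>Q l. card {x\<in>G0 l. fst x * snd x = y})"
      by (rule card_eq_sum_fibres) (use finG0 finQ in \<open>auto simp: Q_def\<close>)
    also have "\<dots> = (\<Sum>y\<in>Q l. R l y)" unfolding R_def using fib by simp
    finally show ?thesis by simp
  qed
  have G0X: "{x\<in>X. 2 ^ j \<le> g x \<and> g x < 2 ^ (j + 1)} = (SIGMA l:S. G0 l)"
  proof -
    have "2 ^ j \<le> q \<and> q < 2 ^ (j + 1) \<longleftrightarrow> r \<le> real q \<and> real q < 2 * r" for q :: nat
      using of_nat_less_iff[of q "2 ^ (j + 1)", where 'a = real] unfolding r_def by simp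
    note iff = this
    show ?thesis
    proof (rule set_eqI)
      fix x :: "real \<times> real \<times> real"
      obtain l y where x: "x = (l, y)" by (cases x)
      show "x \<in> {x\<in>X. 2 ^ j \<le> g x \<and> g x < 2 ^ (j + 1)} \<longleftrightarrow> x \<in> (SIGMA l:S. G0 l)"
        unfolding X_def g_def G0_def x mem_Collect_eq mem_Sigma_iff prod.case
        using iff[of "R l (fst y * snd y)"] by blast
    qed
  qed
  have "n * \<tau> * real (card S) \<le> real (card X)"
  proof -
    have "n * \<tau> * real (card S) = (\<Sum>l\<in>S. n * \<tau>)" by simp
    also have "\<dots> \<le> (\<Sum>l\<in>S. n * real (card (dilation_part A l)))"
      using \<tau>(2) n0 by (intro sum_mono mult_left_mono) auto
    also have "\<dots> = real (card X)" unfolding X_def n_def using finS finA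
      by (simp add: card_cartesian_product)
    finally show ?thesis .
  qed
  also have "\<dots> \<le> real k * real (card (SIGMA l:S. G0 l))" using j unfolding G0X by simp
  also have "\<dots> = real k * (\<Sum>l\<in>S. real (card (G0 l)))" using finS finG0 by simp
  finally have G0sum: "n * \<tau> * real (card S) \<le> real k * (\<Sum>l\<in>S. real (card (G0 l)))" .
  \<comment> \<open>There are at most \<open>2 * n * \<tau>\<close> pairs per slope, and each
    product kept uses up at least \<open>r\<close> of them, so \<open>B\<close> bounds every
    \<open>Q l\<close>.\<close>
  define B where "B = 2 * n * \<tau> / r"
  have B0: "B > 0" unfolding B_def using n0 \<tau> r0 by simp
  have cQ: "real (card (Q l)) \<le> B" if "l \<in> S" for l
  proof -
    have "r * real (card (Q l)) = (\<Sum>y\<in>Q l. r)" by simp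
    also have "\<dots> \<le> (\<Sum>y\<in>Q l. real (R l y))" using QR by (intro sum_mono) auto
    also have "\<dots> = real (card (G0 l))" by (rule cG0[symmetric])
    also have "\<dots> \<le> real (card (A \<times> dilation_part A l))"
      using finA unfolding G0_def by (intro of_nat_mono card_mono) auto
    also have "\<dots> = n * real (card (dilation_part A l))" unfolding n_def by (simp add: card_cartesian_product)
    also have "\<dots> \<le> n * (2 * \<tau>)" using \<tau>(3)[OF that] n0 by (intro mult_left_mono) auto
    finally show ?thesis unfolding B_def using r0 by (simp add: field_simps)
  qed
  have cG0le: "real (card (G0 l)) \<le> 2 * r * real (card (Q l))" for l
  proof -
    have "(\<Sum>y\<in>Q l. real (R l y)) \<le> (\<Sum>y\<in>Q l. 2 * r)"
    proof (rule sum_mono)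
      fix y assume "y \<in> Q l"
      then show "real (R l y) \<le> 2 * r" using QR[of y l] by linarith
    qed
    then have "real (card (G0 l)) \<le> (\<Sum>y\<in>Q l. 2 * r)" by (simp only: cG0)
    then show ?thesis by (simp add: mult.commute)
  qed
  have cQh: "real (card (Q l)) \<le> h" for l
    unfolding h_def using QH finA by (intro of_nat_mono card_mono) auto
  \<comment> \<open>A slope contributes at most \<open>2 * r * h\<close> pairs to \<open>G0\<close>,
    while the average over \<open>S\<close> is at least \<open>n * \<tau> / k\<close>.\<close>
  have Bh: "B \<le> 4 * real k * h"
  proof -
    have "n * \<tau> * real (card S) \<le> real k * (\<Sum>l\<in>S. 2 * r * h)"
      using G0sum
    proof (rule order_trans)
      show "real k * (\<Sum>l\<in>S. real (card (G0 l))) \<le> real k * (\<Sum>l\<in>S. 2 * r * h)"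
      proof (intro mult_left_mono sum_mono)
        fix l
        have "2 * r * real (card (Q l)) \<le> 2 * r * h" using cQh r0 by (intro mult_left_mono) auto
        then show "real (card (G0 l)) \<le> 2 * r * h" using cG0le[of l] by linarith
      qed simp
    qed
    then have "n * \<tau> * real (card S) \<le> (2 * real k * r * h) * real (card S)" by (simp add: mult_ac)
    then have "n * \<tau> \<le> 2 * real k * r * h" using s0 by simp
    then show ?thesis unfolding B_def using r0 by (simp add: field_simps)
  qed
  \<comment> \<open>The threshold solves
    \<open>2 * r * h * \<rho> = n * \<tau> * card S / (2 * k)\<close>: pairs whose product lies in
    fewer than \<open>\<rho>\<close> of the sets \<open>Q m\<close> then make up at most half of the
    guaranteed size of \<open>G0\<close>.\<close>
  define \<rho> where "\<rho> = real (card S) * B / (8 * real k * h)"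
  have \<rho>0: "\<rho> \<ge> 0" unfolding \<rho>_def using B0 h0 by simp
  define c where "c y = card {m\<in>S. y \<in> Q m}" for y
  define G where "G l = {x\<in>G0 l. \<rho> \<le> real (c (fst x * snd x))}" for l
  define Bad where "Bad l = {y\<in>Q l. real (c y) < \<rho>}" for l
  have bad: "real (card (G0 l)) \<le> real (card (G l)) + 2 * r * real (card (Bad l))" for l
  proof -
    have "G0 l = G l \<union> {x\<in>G0 l. fst x * snd x \<in> Bad l}"
      unfolding G_def Bad_def Q_def by auto
    then have "card (G0 l) = card (G l \<union> {x\<in>G0 l. fst x * snd x \<in> Bad l})"
      by (rule arg_cong)
    then have "card (G0 l) \<le> card (G l) + card {x\<in>G0 l. fst x * snd x \<in> Bad l}"
      by (simp only: card_Un_le)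
    moreover have "real (card {x\<in>G0 l. fst x * snd x \<in> Bad l}) \<le> 2 * r * real (card (Bad l))"
    proof (rule card_le_mult_fibres[where f = "\<lambda>x. fst x * snd x"])
      fix y assume y: "y \<in> Bad l"
      then have "y \<in> Q l" unfolding Bad_def by auto
      have "{x \<in> {x\<in>G0 l. fst x * snd x \<in> Bad l}. fst x * snd x = y} = {x\<in>G0 l. fst x * snd x = y}"
        using y by auto
      then have "card {x \<in> {x\<in>G0 l. fst x * snd x \<in> Bad l}. fst x * snd x = y} = R l y"
        unfolding R_def using fib[OF \<open>y \<in> Q l\<close>] by simp
      then show "real (card {x \<in> {x\<in>G0 l. fst x * snd x \<in> Bad l}. fst x * snd x = y}) \<le> 2 * r"
        using QR[OF \<open>y \<in> Q l\<close>] by simp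
    qed (use finG0 finQ in \<open>auto simp: Bad_def\<close>)
    ultimately show ?thesis by linarith
  qed
  have "Bad l = {y \<in> {y\<in>prodset A. real (c y) < \<rho>}. y \<in> Q l}" for l
    unfolding Bad_def using QH(1) by blast
  moreover have "(\<Sum>l\<in>S. card {y \<in> {y\<in>prodset A. real (c y) < \<rho>}. y \<in> Q l})
      = (\<Sum>y\<in>{y\<in>prodset A. real (c y) < \<rho>}. c y)"
    by (rule sum_multicount_gen) (use finS finA in \<open>simp_all add: c_def\<close>)
  ultimately have "(\<Sum>l\<in>S. card (Bad l)) = (\<Sum>y\<in>{y\<in>prodset A. real (c y) < \<rho>}. c y)"
    by (simp only:)
  then have "(\<Sum>l\<in>S. real (card (Bad l))) = (\<Sum>y\<in>{y\<in>prodset A. real (c y) < \<rho>}. real (c y))"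
    by (simp only: of_nat_sum[symmetric])
  also have "\<dots> \<le> (\<Sum>y\<in>{y\<in>prodset A. real (c y) < \<rho>}. \<rho>)" by (intro sum_mono) auto
  also have "\<dots> = real (card {y\<in>prodset A. real (c y) < \<rho>}) * \<rho>" by simp
  also have "\<dots> \<le> h * \<rho>" unfolding h_def using finA \<rho>0 by (intro mult_right_mono of_nat_mono card_mono) auto
  finally have "2 * r * (\<Sum>l\<in>S. real (card (Bad l))) \<le> 2 * r * (h * \<rho>)" using r0 by (intro mult_left_mono) auto
  also have "\<dots> = n * \<tau> * real (card S) / (2 * real k)"
    unfolding \<rho>_def B_def using r0 h0 k by (simp add: field_simps)
  finally have badsum: "2 * r * (\<Sum>l\<in>S. real (card (Bad l))) \<le> n * \<tau> * real (card S) / (2 * real k)" .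
  have "n * \<tau> * real (card S) / real k \<le> (\<Sum>l\<in>S. real (card (G0 l)))"
    using G0sum k by (simp add: field_simps)
  also have "\<dots> \<le> (\<Sum>l\<in>S. real (card (G l)) + 2 * r * real (card (Bad l)))" using bad by (rule sum_mono)
  also have "\<dots> = (\<Sum>l\<in>S. real (card (G l))) + 2 * r * (\<Sum>l\<in>S. real (card (Bad l)))"
    by (simp add: sum.distrib sum_distrib_left)
  finally have "n * \<tau> * real (card S) / (2 * real k) \<le> (\<Sum>l\<in>S. real (card (G l)))"
  proof -
    assume *: "n * \<tau> * real (card S) / real k \<le> (\<Sum>l\<in>S. real (card (G l))) + 2 * r * (\<Sum>l\<in>S. real (card (Bad l)))"
    have "n * \<tau> * real (card S) / real k = n * \<tau> * real (card S) / (2 * real k) + n * \<tau> * real (card S) / (2 * real k)"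
      by (simp add: field_simps)
    moreover have "x = y + y \<Longrightarrow> x \<le> u + v \<Longrightarrow> v \<le> y \<Longrightarrow> y \<le> u" for x y u v :: real by linarith
    ultimately show ?thesis using * badsum by blast
  qed
  note Gsum = this
  show thesis
  proof (rule that[of B \<rho> Q G])
    show "B > 0" by (rule B0)
    show "B \<le> 4 * real k * real (card (prodset A))" using Bh unfolding h_def .
    show "\<rho> = real (card S) * B / (8 * real k * real (card (prodset A)))" unfolding \<rho>_def h_def ..
    show "finite (Q l) \<and> real (card (Q l)) \<le> B" if "l \<in> S" for l using finQ cQ[OF that] by blast
    show "l * y \<in> prodset A" if "l \<in> S" "y \<in> Q l" for l y using QH(2) that by blast
    show "G l \<subseteq> A \<times> dilation_part A l" if "l \<in> S" for l unfolding G_def G0_def by blast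
    show "a * p \<in> Q l \<and> \<rho> \<le> real (card {m\<in>S. a * p \<in> Q m})" if "l \<in> S" "(a, p) \<in> G l" for l a p
    proof -
      have "(a, p) \<in> G0 l" "\<rho> \<le> real (c (a * p))" using that(2) unfolding G_def by auto
      then show ?thesis unfolding Q_def c_def by (auto intro!: image_eqI[of _ _ "(a, p)"])
    qed
    show "real (card A) * \<tau> * real (card S) / (2 * real k) \<le> (\<Sum>l\<in>S. real (card (G l)))"
      using Gsum unfolding n_def .
  qed
qed

subsection \<open>Coincidences of sums\<close>

lemma weighted_sum_between:
  fixes l m p q :: real
  assumes "l < m" "p > 0" "q > 0"
  shows "l * (p + q) < l * p + m * q" "l * p + m * q < m * (p + q)"
  using assms mult_strict_right_mono[of l m p] mult_strict_right_mono[of l m q]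
  by (simp_all add: distrib_left)

text \<open>Sums of two points on different rays through the origin stay between these rays, so only sums
  formed within one block of \<open>N\<close> consecutive slopes can coincide. If \<open>N\<close> is so large that there are
  more such sums than points of \<open>(A + A) \<times> (A + A)\<close>, some four slopes account for many coincidences.\<close>

lemma slope_collisions:
  fixes A S :: "real set" and \<tau> L :: real and N :: nat and G :: "real \<Rightarrow> (real \<times> real) set"
  assumes finA: "finite A" and A: "A \<noteq> {}" and Apos: "\<And>a. a \<in> A \<Longrightarrow> a > 0"
    and finS: "finite S" and S: "S \<noteq> {}"
    and \<tau>: "\<tau> > 0" "\<And>l. l \<in> S \<Longrightarrow> real (card (dilation_part A l)) \<le> 2 * \<tau>"
    and G: "\<And>l. l \<in> S \<Longrightarrow> G l \<subseteq> A \<times> dilation_part A l"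
    and L: "L \<ge> 1" "real (card A) * \<tau> * real (card S) / L \<le> (\<Sum>l\<in>S. real (card (G l)))"
    and N: "N \<le> card S" "8 * L \<le> real N"
      "16 * L ^ 2 * real (card (sumset A)) ^ 2 / (real (card S) * \<tau> ^ 2) \<le> real N"
  obtains l1 l2 l3 l4 where "l1 \<in> S" "l2 \<in> S" "l3 \<in> S" "l4 \<in> S" "l4 \<noteq> l1" "l4 \<noteq> l2" "l4 \<noteq> l3"
    "real (card A) * \<tau> ^ 2 / (16 * L ^ 2 * real N ^ 2)
      \<le> real (card {(a, p, q). (a, p) \<in> G l1 \<and> (a, q) \<in> G l3 \<and>
                      (a, ((l3 - l4) * q - (l1 - l4) * p) / (l2 - l4)) \<in> G l2})"
proof -
  define n where "n = real (card A)"
  define U where "U = real (card (sumset A))"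
  define \<sigma> where "\<sigma> = real (card S)"
  have n0: "n > 0" unfolding n_def using finA A by (simp add: card_gt_0_iff)
  have s0: "\<sigma> > 0" unfolding \<sigma>_def using finS S by (simp add: card_gt_0_iff)
  have N0: "real N > 0" "N > 0" using N(2) L(1) by auto
  have U0: "U > 0"
  proof -
    obtain a where "a \<in> A" using A by auto
    then have "a + a \<in> sumset A" unfolding sumset_def by blast
    then show ?thesis unfolding U_def using finA by (auto simp: card_gt_0_iff)
  qed
  have Gm: "a \<in> A \<and> p \<in> A \<and> l * p \<in> A \<and> p > 0 \<and> p \<in> dilation_part A l" if "l \<in> S" "(a, p) \<in> G l" for l a p
    using G[OF that(1)] that(2) Apos unfolding dilation_part_def by auto
  have finG: "finite (G l)" if "l \<in> S" for l
    by (rule finite_subset[OF G[OF that]]) (use finA in auto)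
  let ?blk = "block_index S N"

  define V where "V = {(a, l, p). l \<in> S \<and> (a, p) \<in> G l}"
  have finV: "finite V"
    by (rule finite_subset[of _ "A \<times> S \<times> A"]) (use finA finS Gm in \<open>auto simp: V_def\<close>)
  have cV: "real (card V) = (\<Sum>l\<in>S. real (card (G l)))"
  proof -
    have "V = (\<lambda>(l, a, p). (a, l, p)) ` (SIGMA l:S. G l)" unfolding V_def by force
    moreover have "inj_on (\<lambda>(l, a, p). (a, l, p)) (SIGMA l:S. G l)" by (auto simp: inj_on_def)
    ultimately have "card V = card (SIGMA l:S. G l)" by (simp add: card_image)
    also have "\<dots> = (\<Sum>l\<in>S. card (G l))" using finS finG by simp
    finally show ?thesis by simp
  qed
  have Vlow: "n * \<tau> * \<sigma> / L \<le> real (card V)" using L(2) unfolding cV n_def \<sigma>_def .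
  have V0: "real (card V) > 0"
  proof -
    have "0 < n * \<tau> * \<sigma> / L" using n0 \<tau>(1) s0 L(1) by simp
    then show ?thesis using Vlow by linarith
  qed

  \<comment> \<open>Both points carry the same \<open>a\<close>, and \<open>F\<close> below retains
    it. A coincidence therefore provides four members of the sets \<open>G\<close> with one common
    \<open>a\<close>.\<close>
  define \<Omega> where "\<Omega> = {((a, l, p), (b, m, q)). (a, l, p) \<in> V \<and> (b, m, q) \<in> V \<and> a = b \<and> l < m \<and> ?blk l = ?blk m}"
  have fin\<Omega>: "finite \<Omega>"
    by (rule finite_subset[of _ "V \<times> V"]) (use finV in \<open>auto simp: \<Omega>_def\<close>)
  define T where "T = real (card \<Omega>)"

  define b where "b = card S div N + 1"
  define key where "key = (\<lambda>(a::real, l, p::real). (a, ?blk l))"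
  have "key ` V \<subseteq> A \<times> {..<b}"
  proof (rule image_subsetI)
    fix x assume "x \<in> V"
    then obtain a l p where x: "x = (a, l, p)" "l \<in> S" "(a, p) \<in> G l" unfolding V_def by auto
    have "?blk l < b" using finS x(2)
    proof (rule block_index_less)
      show "card S \<le> b * N" unfolding b_def using dividend_less_times_div[OF N0(2), of "card S"]
        by (simp add: mult.commute)
    qed
    then show "key x \<in> A \<times> {..<b}" using x Gm unfolding key_def by auto
  qed
  then have "real (card V) ^ 2 \<le> real (card (A \<times> {..<b})) * real (card {(x, x'). x \<in> V \<and> x' \<in> V \<and> key x = key x'})"
    by (intro card_square_le_collisions) (use finV finA in auto)
  also have "real (card (A \<times> {..<b})) = n * real b" unfolding n_def by (simp add: card_cartesian_product)
  finally have 1: "real (card V) ^ 2 \<le> n * real b * real (card {(x, x'). x \<in> V \<and> x' \<in> V \<and> key x = key x'})" .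
  have b2: "real b \<le> 2 * \<sigma> / real N"
  proof -
    have "real (card S div N) \<le> \<sigma> / real N" unfolding \<sigma>_def by (simp add: of_nat_div_le_of_nat)
    moreover have "1 \<le> \<sigma> / real N" unfolding \<sigma>_def using N(1) N0 by simp
    ultimately show ?thesis unfolding b_def by simp
  qed
  \<comment> \<open>Pairs with equal slope give no linear relation. There are at most
    \<open>2 * \<tau>\<close> per element of \<open>V\<close>, and \<open>8 * L \<le> real N\<close>
    makes them at most half of the Cauchy-Schwarz total.\<close>
  define D where "D = {(x, x'). x \<in> V \<and> x' \<in> V \<and> fst x = fst x' \<and> fst (snd x) = fst (snd x')}"
  have finD: "finite D" by (rule finite_subset[of _ "V \<times> V"]) (use finV in \<open>auto simp: D_def\<close>)
  have cD: "real (card D) \<le> 2 * \<tau> * real (card V)"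
  proof (rule card_le_mult_fibres[where f = fst])
    fix x assume "x \<in> V"
    then obtain a l p where x: "x = (a, l, p)" "l \<in> S" "(a, p) \<in> G l" unfolding V_def by auto
    have "card {y\<in>D. fst y = x} \<le> card (dilation_part A l)"
    proof (rule card_inj_on_le[of "\<lambda>y. snd (snd (snd y))"])
      show "inj_on (\<lambda>y. snd (snd (snd y))) {y\<in>D. fst y = x}"
        unfolding D_def x by (auto simp: inj_on_def prod_eq_iff)
      show "(\<lambda>y. snd (snd (snd y))) ` {y\<in>D. fst y = x} \<subseteq> dilation_part A l"
        unfolding D_def x V_def using Gm by auto
    qed (use finA in auto)
    then show "real (card {y\<in>D. fst y = x}) \<le> 2 * \<tau>" using \<tau>(2)[OF x(2)] by linarith
  qed (use finD finV in \<open>auto simp: D_def\<close>)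
  have "{(x, x'). x \<in> V \<and> x' \<in> V \<and> key x = key x'} \<subseteq> \<Omega> \<union> (\<lambda>(x, y). (y, x)) ` \<Omega> \<union> D"
  proof
    fix z assume "z \<in> {(x, x'). x \<in> V \<and> x' \<in> V \<and> key x = key x'}"
    then obtain a l p m q where z: "z = ((a, l, p), (a, m, q))" "(a, l, p) \<in> V" "(a, m, q) \<in> V" "?blk l = ?blk m"
      unfolding key_def by auto
    consider "l < m" | "m < l" | "l = m" by linarith
    then show "z \<in> \<Omega> \<union> (\<lambda>(x, y). (y, x)) ` \<Omega> \<union> D"
    proof cases
      case 1
      then show ?thesis using z unfolding \<Omega>_def by auto
    next
      case 2
      then have "((a, m, q), (a, l, p)) \<in> \<Omega>" using z unfolding \<Omega>_def by auto
      then show ?thesis unfolding z(1) by (auto intro!: image_eqI[of _ _ "((a, m, q), (a, l, p))"])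
    next
      case 3
      then show ?thesis using z unfolding D_def by auto
    qed
  qed
  then have "card {(x, x'). x \<in> V \<and> x' \<in> V \<and> key x = key x'} \<le> card (\<Omega> \<union> (\<lambda>(x, y). (y, x)) ` \<Omega> \<union> D)"
    by (rule card_mono[rotated]) (use fin\<Omega> finD in auto)
  also have "\<dots> \<le> card (\<Omega> \<union> (\<lambda>(x, y). (y, x)) ` \<Omega>) + card D" by (rule card_Un_le)
  also have "card (\<Omega> \<union> (\<lambda>(x, y). (y, x)) ` \<Omega>) \<le> card \<Omega> + card ((\<lambda>(x, y). (y, x)) ` \<Omega>)" by (rule card_Un_le)
  also have "card ((\<lambda>(x, y). (y, x)) ` \<Omega>) \<le> card \<Omega>" using fin\<Omega> by (rule card_image_le)
  finally have 2: "real (card {(x, x'). x \<in> V \<and> x' \<in> V \<and> key x = key x'}) \<le> 2 * T + 2 * \<tau> * real (card V)"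
    using cD unfolding T_def by linarith

  have T_low: "n * \<sigma> * \<tau> ^ 2 * real N / (8 * L ^ 2) \<le> T"
  proof -
    have nb: "n * real b > 0" using n0 unfolding b_def by simp
    have "real (card V) ^ 2 \<le> n * real b * (2 * T + 2 * \<tau> * real (card V))"
      using 1 2 nb by (meson mult_left_mono order_trans less_imp_le)
    then have 3: "real (card V) * (real (card V) / (n * real b)) \<le> 2 * T + 2 * \<tau> * real (card V)"
      using nb by (simp add: pos_divide_le_eq power2_eq_square mult.commute)
    have "\<tau> * real N / (2 * L) = (n * \<tau> * \<sigma> / L) / (n * (2 * \<sigma> / real N))"
      using n0 s0 N0 L(1) by (simp add: field_simps)
    also have "\<dots> \<le> real (card V) / (n * real b)"
    proof (rule frac_le)
      show "n * real b \<le> n * (2 * \<sigma> / real N)" using b2 n0 by (intro mult_left_mono) auto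
    qed (use Vlow nb in auto)
    finally have "real (card V) * (\<tau> * real N / (2 * L)) \<le> real (card V) * (real (card V) / (n * real b))"
      by (rule mult_left_mono) simp
    with 3 have "real (card V) * (\<tau> * real N / (2 * L)) \<le> 2 * T + 2 * \<tau> * real (card V)" by linarith
    moreover have "2 * \<tau> * real (card V) \<le> real (card V) * (\<tau> * real N / (4 * L))"
    proof -
      have "2 * \<tau> \<le> \<tau> * real N / (4 * L)" using N(2) L(1) \<tau>(1) by (simp add: field_simps)
      then have "real (card V) * (2 * \<tau>) \<le> real (card V) * (\<tau> * real N / (4 * L))" by (rule mult_left_mono) simp
      then show ?thesis by (simp add: mult_ac)
    qed
    moreover have "real (card V) * (\<tau> * real N / (2 * L)) = real (card V) * (\<tau> * real N / (4 * L)) + real (card V) * (\<tau> * real N / (4 * L))"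
      using L(1) by (simp add: field_simps)
    moreover have "x = y + y \<Longrightarrow> x \<le> 2 * T + v \<Longrightarrow> v \<le> y \<Longrightarrow> y \<le> 2 * T" for x y v :: real by linarith
    ultimately have 4: "real (card V) * (\<tau> * real N / (4 * L)) \<le> 2 * T" by blast
    have "(n * \<tau> * \<sigma> / L) * (\<tau> * real N / (4 * L)) \<le> real (card V) * (\<tau> * real N / (4 * L))"
      using Vlow \<tau>(1) L(1) by (intro mult_right_mono) auto
    then have "(n * \<tau> * \<sigma> / L) * (\<tau> * real N / (4 * L)) \<le> 2 * T" using 4 by linarith
    moreover have "(n * \<tau> * \<sigma> / L) * (\<tau> * real N / (4 * L)) = 2 * (n * \<sigma> * \<tau> ^ 2 * real N / (8 * L ^ 2))"
      using L(1) by (simp add: field_simps power2_eq_square)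
    ultimately show ?thesis by linarith
  qed
  \<comment> \<open>By the third condition on \<open>N\<close>, \<open>\<Omega>\<close> is at least
    twice as large as the target of \<open>F\<close>. Cauchy-Schwarz then yields at least
    \<open>2 * T\<close> coinciding pairs, of which only \<open>T\<close> are diagonal.\<close>
  have T_U: "2 * (n * U ^ 2) \<le> T"
  proof -
    have "16 * L ^ 2 * U ^ 2 \<le> real N * (\<sigma> * \<tau> ^ 2)"
      using N(3) s0 \<tau>(1) unfolding U_def \<sigma>_def by (simp add: pos_divide_le_eq)
    then have "n * (16 * L ^ 2 * U ^ 2) \<le> n * (real N * (\<sigma> * \<tau> ^ 2))" using n0 by (intro mult_left_mono) auto
    then have "2 * (n * U ^ 2) \<le> n * \<sigma> * \<tau> ^ 2 * real N / (8 * L ^ 2)"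
      using L(1) by (simp add: field_simps)
    then show ?thesis using T_low by linarith
  qed
  have T0: "T > 0" using T_U n0 U0 by (smt (verit) mult_pos_pos zero_less_power)

  define F where "F = (\<lambda>((a::real, l, p), (b::real, m, q)). (a, p + q, l * p + m * q :: real))"
  define C where "C = {(x, x'). x \<in> \<Omega> \<and> x' \<in> \<Omega> \<and> F x = F x'}"
  have finC: "finite C" by (rule finite_subset[of _ "\<Omega> \<times> \<Omega>"]) (use fin\<Omega> in \<open>auto simp: C_def\<close>)
  have "F ` \<Omega> \<subseteq> A \<times> sumset A \<times> sumset A"
    unfolding F_def \<Omega>_def V_def sumset_def using Gm by fastforce
  then have "real (card \<Omega>) ^ 2 \<le> real (card (A \<times> sumset A \<times> sumset A)) * real (card C)"
    unfolding C_def by (intro card_square_le_collisions) (use fin\<Omega> finA in auto)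
  then have "T ^ 2 \<le> n * U ^ 2 * real (card C)"
    unfolding T_def n_def U_def by (simp add: card_cartesian_product power2_eq_square)
  also have "\<dots> \<le> T / 2 * real (card C)" using T_U by (intro mult_right_mono) auto
  finally have "T * (2 * T) \<le> T * real (card C)" by (simp add: power2_eq_square)
  then have C2: "2 * T \<le> real (card C)" using T0 by simp

  define W where "W = (\<lambda>(l1, l2, l3, l4). {(a, p, q). (a, p) \<in> G l1 \<and> (a, q) \<in> G l3 \<and>
                      (a, ((l3 - l4) * q - (l1 - l4) * p) / (l2 - l4)) \<in> G l2})"
  define \<Theta> where "\<Theta> = {(l1, l2, l3, l4). l1 \<in> S \<and> l2 \<in> S \<and> l3 \<in> S \<and> l4 \<in> S \<and> l4 \<noteq> l1 \<and> l4 \<noteq> l2 \<and> l4 \<noteq> l3 \<and>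
      ?blk l2 = ?blk l1 \<and> ?blk l3 = ?blk l1 \<and> ?blk l4 = ?blk l1}"
  have fin\<Theta>: "finite \<Theta>"
    by (rule finite_subset[of _ "S \<times> S \<times> S \<times> S"]) (use finS in \<open>auto simp: \<Theta>_def\<close>)
  have finW: "finite (W x)" if "x \<in> \<Theta>" for x
    by (rule finite_subset[of _ "A \<times> A \<times> A"]) (use finA that Gm in \<open>auto simp: W_def \<Theta>_def\<close>)
  have c\<Theta>: "real (card \<Theta>) \<le> \<sigma> * real N ^ 3"
  proof -
    let ?B = "\<lambda>l. {m\<in>S. ?blk m = ?blk l}"
    have "card \<Theta> \<le> card (SIGMA l:S. ?B l \<times> ?B l \<times> ?B l)"
      by (rule card_mono) (use finS in \<open>auto simp: \<Theta>_def\<close>)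
    also have "\<dots> = (\<Sum>l\<in>S. card (?B l \<times> ?B l \<times> ?B l))" using finS by simp
    also have "\<dots> \<le> (\<Sum>l\<in>S. N * (N * N))"
      unfolding card_cartesian_product
      by (intro sum_mono mult_mono card_block_index_fibre finS N0) auto
    finally have "card \<Theta> \<le> card S * (N * (N * N))" by simp
    then have "real (card \<Theta>) \<le> real (card S * (N * (N * N)))" by (rule of_nat_mono)
    then show ?thesis unfolding \<sigma>_def by (simp add: power3_eq_cube)
  qed
  have dest: "l \<in> S \<and> m \<in> S \<and> l < m \<and> ?blk l = ?blk m \<and> (a, p) \<in> G l \<and> (a, q) \<in> G m \<and> p > 0 \<and> q > 0 \<and> b = a"
    if "((a, l, p), (b, m, q)) \<in> \<Omega>" for a l p b m q
    using that Gm unfolding \<Omega>_def V_def by auto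
  \<comment> \<open>If the block of the first pair lay below that of the second, the directions of
    the two sums would be strictly separated. Applied both ways round, this puts all four slopes
    into one block.\<close>
  have blocks: "\<not> ?blk l2 < ?blk l3"
    if "((a, l1, p1), (b, l2, p2)) \<in> \<Omega>" "((a', l3, p3), (b', l4, p4)) \<in> \<Omega>"
       "p1 + p2 = p3 + p4" "l1 * p1 + l2 * p2 = l3 * p3 + l4 * p4" for a l1 p1 b l2 p2 a' l3 p3 b' l4 p4
  proof
    assume lt: "?blk l2 < ?blk l3"
    have "l2 < l3"
    proof (rule ccontr)
      assume "\<not> l2 < l3"
      then have "?blk l3 \<le> ?blk l2" using block_index_mono[OF finS] by simp
      then show False using lt by simp
    qed
    have "l1 * p1 + l2 * p2 < l2 * (p1 + p2)"
      using weighted_sum_between(2)[of l1 l2 p1 p2] dest[OF that(1)] by blast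
    also have "\<dots> < l3 * (p3 + p4)"
      unfolding that(3) using \<open>l2 < l3\<close> dest[OF that(2)] by (intro mult_strict_right_mono) auto
    also have "\<dots> < l3 * p3 + l4 * p4"
      using weighted_sum_between(1)[of l3 l4 p3 p4] dest[OF that(2)] by blast
    finally show False using that(4) by simp
  qed
  \<comment> \<open>A nontrivial coincidence has a slope in its second pair that is missing from the
    first. That slope takes the role of \<open>l4\<close>, which makes \<open>l2 - l4\<close> and
    \<open>l1 - l4\<close> nonzero; \<open>O2\<close> differs from \<open>O1\<close> by exchanging
    the points of the second pair.\<close>
  define O1 where "O1 = {((x, y), (x', y')). ((x, y), (x', y')) \<in> C \<and> fst (snd y') \<notin> {fst (snd x), fst (snd y)}}"
  define O2 where "O2 = {((x, y), (x', y')). ((x, y), (x', y')) \<in> C \<and> fst (snd x') \<notin> {fst (snd x), fst (snd y)}}"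
  have finO: "finite O1" "finite O2"
    by (rule finite_subset[OF _ finC], auto simp: O1_def O2_def)+
  have C_elim: "\<exists>a l1 p1 l2 p2 l3 p3 l4 p4. z = (((a, l1, p1), (a, l2, p2)), ((a, l3, p3), (a, l4, p4)))
      \<and> l1 \<in> S \<and> l2 \<in> S \<and> l3 \<in> S \<and> l4 \<in> S \<and> l1 < l2 \<and> l3 < l4
      \<and> ?blk l2 = ?blk l1 \<and> ?blk l3 = ?blk l1 \<and> ?blk l4 = ?blk l1
      \<and> (a, p1) \<in> G l1 \<and> (a, p2) \<in> G l2 \<and> (a, p3) \<in> G l3 \<and> (a, p4) \<in> G l4
      \<and> p1 + p2 = p3 + p4 \<and> l1 * p1 + l2 * p2 = l3 * p3 + l4 * p4" if "z \<in> C" for z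
  proof -
    obtain a l1 p1 b l2 p2 a' l3 p3 b' l4 p4 where z: "z = (((a, l1, p1), (b, l2, p2)), ((a', l3, p3), (b', l4, p4)))"
      by (metis prod.collapse)
    have \<Omega>1: "((a, l1, p1), (b, l2, p2)) \<in> \<Omega>" and \<Omega>2: "((a', l3, p3), (b', l4, p4)) \<in> \<Omega>"
      and eq: "a = a'" "p1 + p2 = p3 + p4" "l1 * p1 + l2 * p2 = l3 * p3 + l4 * p4"
      using that unfolding C_def z F_def by auto
    have "\<not> ?blk l2 < ?blk l3" by (rule blocks[OF \<Omega>1 \<Omega>2 eq(2,3)])
    moreover have "\<not> ?blk l4 < ?blk l1" by (rule blocks[OF \<Omega>2 \<Omega>1 eq(2,3)[symmetric]])
    ultimately have "?blk l2 = ?blk l1 \<and> ?blk l3 = ?blk l1 \<and> ?blk l4 = ?blk l1"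
      using dest[OF \<Omega>1] dest[OF \<Omega>2] by linarith
    then show ?thesis using z eq dest[OF \<Omega>1] dest[OF \<Omega>2] by blast
  qed
  \<comment> \<open>Eliminating \<open>p4 = p1 + p2 - p3\<close> from the two coordinates gives a
    linear relation with the coefficients \<open>l1 - l4\<close>, \<open>l2 - l4\<close>,
    \<open>l3 - l4\<close>.\<close>
  have solve: "p2 = ((l3 - l4) * p3 - (l1 - l4) * p1) / (l2 - l4)"
    if "p1 + p2 = p3 + p4" "l1 * p1 + l2 * p2 = l3 * p3 + l4 * p4" "l4 \<noteq> l2"
    for l1 l2 l3 l4 p1 p2 p3 p4 :: real
  proof -
    have "(l2 - l4) * p2 = (l3 - l4) * p3 - (l1 - l4) * p1"
      using that(1,2) by algebra
    then show ?thesis using that(3) by (simp add: field_simps)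
  qed
  have inj: "card O1 \<le> card (SIGMA x:\<Theta>. W x)" "card O2 \<le> card (SIGMA x:\<Theta>. W x)"
  proof -
    let ?f1 = "\<lambda>(((a::real, l1::real, p1::real), (b::real, l2::real, p2::real)), ((a'::real, l3::real, p3::real), (b'::real, l4::real, p4::real))). ((l1, l2, l3, l4), (a, p1, p3))"
    let ?f2 = "\<lambda>(((a::real, l1::real, p1::real), (b::real, l2::real, p2::real)), ((a'::real, l3::real, p3::real), (b'::real, l4::real, p4::real))). ((l1, l2, l4, l3), (a, p1, p4))"
    have finSW: "finite (SIGMA x:\<Theta>. W x)" using fin\<Theta> finW by auto
    show "card O1 \<le> card (SIGMA x:\<Theta>. W x)"
    proof (rule card_inj_on_le[of ?f1])
      show "?f1 ` O1 \<subseteq> (SIGMA x:\<Theta>. W x)"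
      proof (rule image_subsetI)
        fix z assume z: "z \<in> O1"
        then have "z \<in> C" unfolding O1_def by auto
        from C_elim[OF this] obtain a l1 p1 l2 p2 l3 p3 l4 p4 where
          *: "z = (((a, l1, p1), (a, l2, p2)), ((a, l3, p3), (a, l4, p4)))"
          "l1 \<in> S" "l2 \<in> S" "l3 \<in> S" "l4 \<in> S" "l1 < l2" "l3 < l4"
          "?blk l2 = ?blk l1" "?blk l3 = ?blk l1" "?blk l4 = ?blk l1"
          "(a, p1) \<in> G l1" "(a, p2) \<in> G l2" "(a, p3) \<in> G l3" "(a, p4) \<in> G l4"
          "p1 + p2 = p3 + p4" "l1 * p1 + l2 * p2 = l3 * p3 + l4 * p4" by blast
        have ne: "l4 \<noteq> l1" "l4 \<noteq> l2" using z unfolding O1_def *(1) by auto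
        have "p2 = ((l3 - l4) * p3 - (l1 - l4) * p1) / (l2 - l4)" by (rule solve[OF *(15,16) ne(2)])
        then show "?f1 z \<in> (SIGMA x:\<Theta>. W x)" unfolding *(1) \<Theta>_def W_def using *(2-14) ne by auto
      qed
      show "inj_on ?f1 O1"
      proof (rule inj_onI)
        fix z z' assume z: "z \<in> O1" "z' \<in> O1" "?f1 z = ?f1 z'"
        then have "z \<in> C" "z' \<in> C" unfolding O1_def by auto
        from C_elim[OF this(1)] C_elim[OF this(2)] obtain a l1 p1 l2 p2 l3 p3 l4 p4 b m1 q1 m2 q2 m3 q3 m4 q4 where
          *: "z = (((a, l1, p1), (a, l2, p2)), ((a, l3, p3), (a, l4, p4)))"
          "p1 + p2 = p3 + p4" "l1 * p1 + l2 * p2 = l3 * p3 + l4 * p4" and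
          **: "z' = (((b, m1, q1), (b, m2, q2)), ((b, m3, q3), (b, m4, q4)))"
          "q1 + q2 = q3 + q4" "m1 * q1 + m2 * q2 = m3 * q3 + m4 * q4" by blast
        have ne: "l4 \<noteq> l2" using z(1) unfolding O1_def *(1) by auto
        have e: "l1 = m1" "l2 = m2" "l3 = m3" "l4 = m4" "a = b" "p1 = q1" "p3 = q3"
          using z(3) unfolding *(1) **(1) by auto
        have "p2 = q2" using solve[OF *(2,3) ne] solve[OF **(2,3)] ne unfolding e by simp
        moreover have "p4 = q4" using *(2) **(2) \<open>p2 = q2\<close> e by linarith
        ultimately show "z = z'" unfolding *(1) **(1) using e by simp
      qed
    qed (rule finSW)
    show "card O2 \<le> card (SIGMA x:\<Theta>. W x)"
    proof (rule card_inj_on_le[of ?f2])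
      show "?f2 ` O2 \<subseteq> (SIGMA x:\<Theta>. W x)"
      proof (rule image_subsetI)
        fix z assume z: "z \<in> O2"
        then have "z \<in> C" unfolding O2_def by auto
        from C_elim[OF this] obtain a l1 p1 l2 p2 l3 p3 l4 p4 where
          *: "z = (((a, l1, p1), (a, l2, p2)), ((a, l3, p3), (a, l4, p4)))"
          "l1 \<in> S" "l2 \<in> S" "l3 \<in> S" "l4 \<in> S" "l1 < l2" "l3 < l4"
          "?blk l2 = ?blk l1" "?blk l3 = ?blk l1" "?blk l4 = ?blk l1"
          "(a, p1) \<in> G l1" "(a, p2) \<in> G l2" "(a, p3) \<in> G l3" "(a, p4) \<in> G l4"
          "p1 + p2 = p3 + p4" "l1 * p1 + l2 * p2 = l3 * p3 + l4 * p4" by blast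
        have ne: "l3 \<noteq> l1" "l3 \<noteq> l2" using z unfolding O2_def *(1) by auto
        have "p1 + p2 = p4 + p3" "l1 * p1 + l2 * p2 = l4 * p4 + l3 * p3" using *(15,16) by simp_all
        then have "p2 = ((l4 - l3) * p4 - (l1 - l3) * p1) / (l2 - l3)" by (rule solve[OF _ _ ne(2)])
        then show "?f2 z \<in> (SIGMA x:\<Theta>. W x)" unfolding *(1) \<Theta>_def W_def using *(2-14) ne by auto
      qed
      show "inj_on ?f2 O2"
      proof (rule inj_onI)
        fix z z' assume z: "z \<in> O2" "z' \<in> O2" "?f2 z = ?f2 z'"
        then have "z \<in> C" "z' \<in> C" unfolding O2_def by auto
        from C_elim[OF this(1)] C_elim[OF this(2)] obtain a l1 p1 l2 p2 l3 p3 l4 p4 b m1 q1 m2 q2 m3 q3 m4 q4 where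
          *: "z = (((a, l1, p1), (a, l2, p2)), ((a, l3, p3), (a, l4, p4)))"
          "p1 + p2 = p3 + p4" "l1 * p1 + l2 * p2 = l3 * p3 + l4 * p4" and
          **: "z' = (((b, m1, q1), (b, m2, q2)), ((b, m3, q3), (b, m4, q4)))"
          "q1 + q2 = q3 + q4" "m1 * q1 + m2 * q2 = m3 * q3 + m4 * q4" by blast
        have ne: "l3 \<noteq> l2" using z(1) unfolding O2_def *(1) by auto
        have e: "l1 = m1" "l2 = m2" "l3 = m3" "l4 = m4" "a = b" "p1 = q1" "p4 = q4"
          using z(3) unfolding *(1) **(1) by auto
        have "p1 + p2 = p4 + p3" "l1 * p1 + l2 * p2 = l4 * p4 + l3 * p3"
          "q1 + q2 = q4 + q3" "m1 * q1 + m2 * q2 = m4 * q4 + m3 * q3" using *(2,3) **(2,3) by simp_all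
        then have "p2 = q2" using solve[of p1 p2 p4 p3 l1 l2 l4 l3] solve[of q1 q2 q4 q3 m1 m2 m4 m3] ne unfolding e by simp
        moreover have "p3 = q3" using *(2) **(2) \<open>p2 = q2\<close> e by linarith
        ultimately show "z = z'" unfolding *(1) **(1) using e by simp
      qed
    qed (rule finSW)
  qed
  \<comment> \<open>Outside \<open>O1\<close> and \<open>O2\<close> the ordering of the slopes
    leaves only \<open>l3 = l1\<close> and \<open>l4 = l2\<close>; a vector decomposes uniquely
    along two different directions, so the coincidence is diagonal.\<close>
  have "C \<subseteq> (\<lambda>x. (x, x)) ` \<Omega> \<union> (O1 \<union> O2)"
  proof
    fix z assume zC: "z \<in> C"
    from C_elim[OF this] obtain a l1 p1 l2 p2 l3 p3 l4 p4 where
      *: "z = (((a, l1, p1), (a, l2, p2)), ((a, l3, p3), (a, l4, p4)))" "l1 < l2" "l3 < l4"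
      "p1 + p2 = p3 + p4" "l1 * p1 + l2 * p2 = l3 * p3 + l4 * p4" by blast
    show "z \<in> (\<lambda>x. (x, x)) ` \<Omega> \<union> (O1 \<union> O2)"
    proof (cases "l3 \<in> {l1, l2} \<and> l4 \<in> {l1, l2}")
      case True
      then have e: "l3 = l1" "l4 = l2" using *(2,3) by auto
      have "(l1 - l2) * (p1 - p3) = 0" using *(4,5) unfolding e by algebra
      then have "p1 = p3" using *(2) by simp
      then have "p2 = p4" using *(4) by simp
      then have "z = (((a, l1, p1), (a, l2, p2)), ((a, l1, p1), (a, l2, p2)))" using *(1) e \<open>p1 = p3\<close> by simp
      moreover have "((a, l1, p1), (a, l2, p2)) \<in> \<Omega>" using zC unfolding C_def *(1) by auto
      ultimately show ?thesis by blast
    next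
      case False
      then show ?thesis using zC unfolding O1_def O2_def *(1) by auto
    qed
  qed
  then have "card C \<le> card ((\<lambda>x. (x, x)) ` \<Omega> \<union> (O1 \<union> O2))"
    by (rule card_mono[rotated]) (use fin\<Omega> finO in auto)
  also have "\<dots> \<le> card ((\<lambda>x. (x, x)) ` \<Omega>) + card (O1 \<union> O2)" by (rule card_Un_le)
  also have "card ((\<lambda>x. (x, x)) ` \<Omega>) \<le> card \<Omega>" using fin\<Omega> by (rule card_image_le)
  also have "card (O1 \<union> O2) \<le> card O1 + card O2" by (rule card_Un_le)
  finally have "card C \<le> card \<Omega> + (card O1 + card O2)" by simp
  then have "card C \<le> card \<Omega> + 2 * card (SIGMA x:\<Theta>. W x)" using inj by linarith
  then have "real (card C) \<le> T + 2 * real (card (SIGMA x:\<Theta>. W x))" unfolding T_def by linarith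
  then have "T \<le> 2 * real (card (SIGMA x:\<Theta>. W x))" using C2 by linarith
  also have "card (SIGMA x:\<Theta>. W x) = (\<Sum>x\<in>\<Theta>. card (W x))" using fin\<Theta> finW by simp
  finally have TW: "T \<le> 2 * (\<Sum>x\<in>\<Theta>. real (card (W x)))" by simp
  \<comment> \<open>Half of the lower bound \<open>T_low\<close>, divided among the at most
    \<open>\<sigma> * real N ^ 3\<close> quadruples: the first slope is free and the other three lie
    in its block.\<close>
  define w where "w = n * \<tau> ^ 2 / (16 * L ^ 2 * real N ^ 2)"
  have w0: "w > 0" unfolding w_def using n0 \<tau>(1) L(1) N0 by simp
  have "\<exists>x\<in>\<Theta>. w \<le> real (card (W x))"
  proof (rule ccontr)
    assume "\<not> ?thesis"
    then have lt: "real (card (W x)) < w" if "x \<in> \<Theta>" for x using that by (simp add: not_le)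
    have "\<Theta> \<noteq> {}" using TW T0 by auto
    then have "(\<Sum>x\<in>\<Theta>. real (card (W x))) < (\<Sum>x\<in>\<Theta>. w)" using fin\<Theta> lt by (intro sum_strict_mono) auto
    also have "\<dots> = real (card \<Theta>) * w" by simp
    also have "\<dots> \<le> \<sigma> * real N ^ 3 * w" using c\<Theta> w0 by (intro mult_right_mono) auto
    also have "\<dots> = (n * \<sigma> * \<tau> ^ 2 * real N / (8 * L ^ 2)) / 2"
      unfolding w_def using N0 by (simp add: field_simps power3_eq_cube power2_eq_square)
    also have "\<dots> \<le> T / 2" by (rule divide_right_mono[OF T_low]) simp
    finally show False using TW by simp
  qed
  then obtain l1 l2 l3 l4 where "(l1, l2, l3, l4) \<in> \<Theta>" "w \<le> real (card (W (l1, l2, l3, l4)))" by auto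
  then show thesis using that[of l1 l2 l3 l4] unfolding \<Theta>_def W_def w_def n_def by simp
qed

subsection \<open>Dilated solutions\<close>

text \<open>A dilate \<open>(a p, a q)\<close> determines the slope \<open>q / p\<close>, so few dilates coincide because the relevant
  multiplicative energy is small.\<close>

lemma card_dilates_ge:
  fixes A :: "real set" and l1 l2 l3 l4 t :: real and G :: "real \<Rightarrow> (real \<times> real) set" and k :: nat
  assumes finA: "finite A" and Apos: "\<And>a. a \<in> A \<Longrightarrow> a > 0"
    and G: "\<And>l. l \<in> {l1, l2, l3} \<Longrightarrow> G l \<subseteq> A \<times> dilation_part A l"
    and t: "\<And>l. l \<in> {l1, l2, l3} \<Longrightarrow> real (card (dilation_part A l)) \<le> t" "t \<ge> 1" "t < 2 ^ k"
    and l: "l4 \<noteq> l1" "l4 \<noteq> l2" "l4 \<noteq> l3"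
  defines "W \<equiv> {(a, p, q). (a, p) \<in> G l1 \<and> (a, q) \<in> G l3 \<and>
                  (a, ((l3 - l4) * q - (l1 - l4) * p) / (l2 - l4)) \<in> G l2}"
  shows "real (card W) ^ 6 \<le> 2113536 * real k * real (card A) ^ 5 * t ^ 10
           * real (card ((\<lambda>(a, p, q). (a * p, a * q)) ` W))"
proof (cases "W = {}")
  case True
  then show ?thesis by simp
next
  case False
  define n where "n = real (card A)"
  define c1 where "c1 = l1 - l4"
  define c2 where "c2 = l2 - l4"
  define c3 where "c3 = l3 - l4"
  define P1 where "P1 = dilation_part A l1"
  define P2 where "P2 = dilation_part A l2"
  define P3 where "P3 = dilation_part A l3"
  have c: "c1 \<noteq> 0" "c2 \<noteq> 0" "c3 \<noteq> 0" unfolding c1_def c2_def c3_def using l by auto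
  have finP: "finite P1" "finite P2" "finite P3" unfolding P1_def P2_def P3_def using finA by auto
  have cP: "real (card P1) \<le> t" "real (card P2) \<le> t" "real (card P3) \<le> t"
    unfolding P1_def P2_def P3_def using t(1) by auto
  have Ppos: "p > 0" if "p \<in> P1 \<or> p \<in> P3" for p
    using that Apos unfolding P1_def P3_def dilation_part_def by auto
  have Wm: "a \<in> A \<and> p \<in> P1 \<and> q \<in> P3 \<and> (c3 * q - c1 * p) / c2 \<in> P2" if "(a, p, q) \<in> W" for a p q
    using that G unfolding W_def P1_def P2_def P3_def c1_def c2_def c3_def by auto
  have finW: "finite W"
    by (rule finite_subset[of _ "A \<times> P1 \<times> P3"]) (use finA finP Wm in auto)
  define w where "w = real (card W)"
  have w0: "w > 0" unfolding w_def using False finW by (simp add: card_gt_0_iff)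
  have n0: "n > 0"
  proof -
    obtain a p q where "(a, p, q) \<in> W" using False by auto
    then have "a \<in> A" using Wm by blast
    then show ?thesis unfolding n_def using finA by (auto simp: card_gt_0_iff)
  qed
  have t0: "t > 0" using t(2) by simp
  define f1 where "f1 = (\<lambda>x::real\<times>real\<times>real. fst (snd x))"
  define f3 where "f3 = (\<lambda>x::real\<times>real\<times>real. snd (snd x))"
  \<comment> \<open>There are at most \<open>t\<close> values of either coordinate, so the threshold
    \<open>w / (4 * t)\<close> removes at most \<open>w / 4\<close> solutions for each of them and
    half of \<open>W\<close> remains.\<close>
  define Lt1 where "Lt1 = {x\<in>W. real (card {x'\<in>W. f1 x' = f1 x}) < w / (4 * t)}"
  define Lt3 where "Lt3 = {x\<in>W. real (card {x'\<in>W. f3 x' = f3 x}) < w / (4 * t)}"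
  define W' where "W' = W - (Lt1 \<union> Lt3)"
  have "real (card Lt1) \<le> w / (4 * t) * real (card P1)"
    unfolding Lt1_def by (rule card_light_fibres_le) (use finW finP Wm w0 t0 in \<open>auto simp: f1_def\<close>)
  also have "\<dots> \<le> w / (4 * t) * t" using cP w0 t0 by (intro mult_left_mono) auto
  finally have Lt1: "real (card Lt1) \<le> w / 4" using t0 by simp
  have "real (card Lt3) \<le> w / (4 * t) * real (card P3)"
    unfolding Lt3_def by (rule card_light_fibres_le) (use finW finP Wm w0 t0 in \<open>auto simp: f3_def\<close>)
  also have "\<dots> \<le> w / (4 * t) * t" using cP w0 t0 by (intro mult_left_mono) auto
  finally have Lt3: "real (card Lt3) \<le> w / 4" using t0 by simp
  have finW': "finite W'" unfolding W'_def using finW by simp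
  have "W \<subseteq> W' \<union> (Lt1 \<union> Lt3)" unfolding W'_def by auto
  then have "card W \<le> card (W' \<union> (Lt1 \<union> Lt3))"
    by (rule card_mono[rotated]) (use finW finW' in \<open>auto simp: Lt1_def Lt3_def\<close>)
  also have "\<dots> \<le> card W' + (card Lt1 + card Lt3)"
    by (meson add_left_mono card_Un_le order_trans)
  finally have W'w: "w / 2 \<le> real (card W')" unfolding w_def using Lt1 Lt3 unfolding w_def by linarith
  \<comment> \<open>A popular value of one coordinate lies in at least \<open>w / (4 * t)\<close>
    solutions. Each relation among the three points occurs for at most \<open>n\<close> values of
    \<open>a\<close>, which leaves at least \<open>d\<close> distinct relations through that
    value.\<close>
  define d where "d = w / (4 * t * n)"
  have d0: "d > 0" unfolding d_def using w0 t0 n0 by simp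
  define R1 where "R1 = f1 ` W'"
  define R3 where "R3 = f3 ` W'"
  have R: "R1 \<subseteq> P1" "R3 \<subseteq> P3" unfolding R1_def R3_def f1_def f3_def W'_def using Wm by auto
  have d1: "d \<le> real (card {q\<in>P2. (c1 * p + c2 * q) / c3 \<in> P3})" if "p \<in> R1" for p
  proof -
    from that obtain x where x: "x \<in> W'" "p = f1 x" unfolding R1_def by auto
    then have "w / (4 * t) \<le> real (card {x'\<in>W. f1 x' = p})" unfolding W'_def Lt1_def by auto
    also have "\<dots> \<le> n * real (card {q\<in>P2. (c1 * p + c2 * q) / c3 \<in> P3})"
    proof (rule card_le_mult_fibres[where f = "\<lambda>x. (c3 * f3 x - c1 * p) / c2"])
      show "(\<lambda>x. (c3 * f3 x - c1 * p) / c2) ` {x'\<in>W. f1 x' = p} \<subseteq> {q\<in>P2. (c1 * p + c2 * q) / c3 \<in> P3}"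
        using Wm c unfolding f1_def f3_def by auto
      fix y
      let ?F = "{x \<in> {x'\<in>W. f1 x' = p}. (c3 * f3 x - c1 * p) / c2 = y}"
      have "card ?F \<le> card A"
      proof (rule card_inj_on_le[of fst])
        show "inj_on fst ?F"
        proof (rule inj_onI)
          fix u v assume uv: "u \<in> ?F" "v \<in> ?F" "fst u = fst v"
          then have "c3 * f3 u = c3 * f3 v" using c(2) by (auto simp: field_simps)
          then have "f3 u = f3 v" using c(3) by simp
          then show "u = v" using uv unfolding f1_def f3_def by (auto simp: prod_eq_iff)
        qed
        show "fst ` ?F \<subseteq> A" using Wm by auto
      qed (rule finA)
      then show "real (card ?F) \<le> n" unfolding n_def by simp
    qed (use finW finP in auto)
    finally show ?thesis unfolding d_def using n0 t0 by (simp add: field_simps)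
  qed
  have d3: "d \<le> real (card {q\<in>P2. (c3 * p - c2 * q) / c1 \<in> P1})" if "p \<in> R3" for p
  proof -
    from that obtain x where x: "x \<in> W'" "p = f3 x" unfolding R3_def by auto
    then have "w / (4 * t) \<le> real (card {x'\<in>W. f3 x' = p})" unfolding W'_def Lt3_def by auto
    also have "\<dots> \<le> n * real (card {q\<in>P2. (c3 * p - c2 * q) / c1 \<in> P1})"
    proof (rule card_le_mult_fibres[where f = "\<lambda>x. (c3 * p - c1 * f1 x) / c2"])
      show "(\<lambda>x. (c3 * p - c1 * f1 x) / c2) ` {x'\<in>W. f3 x' = p} \<subseteq> {q\<in>P2. (c3 * p - c2 * q) / c1 \<in> P1}"
        using Wm c unfolding f1_def f3_def by auto
      fix y
      let ?F = "{x \<in> {x'\<in>W. f3 x' = p}. (c3 * p - c1 * f1 x) / c2 = y}"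
      have "card ?F \<le> card A"
      proof (rule card_inj_on_le[of fst])
        show "inj_on fst ?F"
        proof (rule inj_onI)
          fix u v assume uv: "u \<in> ?F" "v \<in> ?F" "fst u = fst v"
          then have "c1 * f1 u = c1 * f1 v" using c(2) by (auto simp: field_simps)
          then have "f1 u = f1 v" using c(1) by simp
          then show "u = v" using uv unfolding f1_def f3_def by (auto simp: prod_eq_iff)
        qed
        show "fst ` ?F \<subseteq> A" using Wm by auto
      qed (rule finA)
      then show "real (card ?F) \<le> n" unfolding n_def by simp
    qed (use finW finP in auto)
    finally show ?thesis unfolding d_def using n0 t0 by (simp add: field_simps)
  qed
  define En where "En = {(x, x'). x \<in> R1 \<times> R3 \<and> x' \<in> R1 \<times> R3 \<and> snd x / fst x = snd x' / fst x'}"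
  have finEn: "finite En"
    by (rule finite_subset[of _ "(P1 \<times> P3) \<times> (P1 \<times> P3)"]) (use finP R in \<open>auto simp: En_def\<close>)
  have En: "real (card En) \<le> 2064 * real k * t ^ 6 / d ^ 4"
    unfolding En_def
    by (rule multiplicative_energy_le[OF finP c cP R _ _ d1 d3 d0 t(3,2)]) (use Ppos R in auto)
  define D where "D = (\<lambda>(a::real, p, q). (a * p, a * q))"
  define Co where "Co = {(x, x'). x \<in> W' \<and> x' \<in> W' \<and> D x = D x'}"
  \<comment> \<open>From \<open>a p = a' p'\<close> and \<open>a q = a' q'\<close> follows
    \<open>q / p = q' / p'\<close>. Conversely \<open>a\<close>, \<open>(p, q)\<close> and
    \<open>(p', q')\<close> determine \<open>a'\<close>, so each energy quadruple accounts for at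
    most \<open>n\<close> coinciding dilates.\<close>
  have "card Co \<le> card (A \<times> En)"
  proof (rule card_inj_on_le[of "\<lambda>(x, x'). (fst x, (snd x, snd x'))"])
    have Co_dest: "fst x \<in> A \<and> fst x' \<in> A \<and> f1 x > 0 \<and> f1 x' > 0 \<and> fst x > 0 \<and> fst x' > 0 \<and>
        fst x * f1 x = fst x' * f1 x' \<and> fst x * f3 x = fst x' * f3 x' \<and>
        f1 x \<in> R1 \<and> f1 x' \<in> R1 \<and> f3 x \<in> R3 \<and> f3 x' \<in> R3" if "(x, x') \<in> Co" for x x'
    proof -
      have m: "x \<in> W'" "x' \<in> W'" "D x = D x'" using that unfolding Co_def by auto
      obtain a p q a' p' q' where x: "x = (a, p, q)" "x' = (a', p', q')" by (metis prod.collapse)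
      have "(a, p, q) \<in> W" "(a', p', q') \<in> W" using m unfolding x W'_def by auto
      then have "a \<in> A" "a' \<in> A" "p > 0" "p' > 0" using Wm Ppos by blast+
      then show ?thesis using m Apos unfolding x D_def R1_def R3_def f1_def f3_def by force
    qed
    show "inj_on (\<lambda>(x, x'). (fst x, (snd x, snd x'))) Co"
    proof (rule inj_onI)
      fix u v assume uv: "u \<in> Co" "v \<in> Co"
        "(case u of (x, x') \<Rightarrow> (fst x, (snd x, snd x'))) = (case v of (x, x') \<Rightarrow> (fst x, (snd x, snd x')))"
      obtain x x' y y' where e: "u = (x, x')" "v = (y, y')" by (metis prod.collapse)
      have xy: "x = y" "snd x' = snd y'" using uv(3) unfolding e by (auto simp: prod_eq_iff)
      have "fst x' * f1 x' = fst y' * f1 y'" using Co_dest[of x x'] Co_dest[of y y'] uv unfolding e xy by metis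
      moreover have "f1 x' = f1 y'" using xy unfolding f1_def by simp
      moreover have "f1 y' > 0" using Co_dest[of y y'] uv unfolding e by blast
      ultimately have "fst x' = fst y'" by simp
      then show "u = v" using xy unfolding e by (simp add: prod_eq_iff)
    qed
    show "(\<lambda>(x, x'). (fst x, (snd x, snd x'))) ` Co \<subseteq> A \<times> En"
    proof (rule image_subsetI)
      fix u assume u: "u \<in> Co"
      obtain x x' where e: "u = (x, x')" by (cases u)
      note dst = Co_dest[OF u[unfolded e]]
      have "f3 x / f1 x = f3 x' / f1 x'"
      proof -
        have "fst x * (f3 x * f1 x') * fst x' = fst x * (f3 x' * f1 x) * fst x'"
        proof -
          have "fst x * (f3 x * f1 x') * fst x' = (fst x * f3 x) * (fst x' * f1 x')" by (simp add: mult_ac)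
          also have "\<dots> = (fst x' * f3 x') * (fst x * f1 x)" using dst by simp
          finally show ?thesis by (simp add: mult_ac)
        qed
        then have "f3 x * f1 x' = f3 x' * f1 x" using dst by simp
        then show ?thesis using dst by (simp add: frac_eq_eq)
      qed
      then show "(case u of (x, x') \<Rightarrow> (fst x, (snd x, snd x'))) \<in> A \<times> En"
        using dst unfolding e En_def f1_def f3_def by (auto simp: mem_Times_iff)
    qed
  qed (use finA finEn in auto)
  then have "real (card Co) \<le> real (card (A \<times> En))" by (rule of_nat_mono)
  then have Co: "real (card Co) \<le> n * real (card En)" unfolding n_def by (simp add: card_cartesian_product)
  let ?T = "real (card (D ` W))"
  have "(w / 2) ^ 2 \<le> real (card W') ^ 2" using W'w w0 by (intro power_mono) auto
  also have "\<dots> \<le> ?T * real (card Co)"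
    unfolding Co_def by (rule card_square_le_collisions) (use finW' finW in \<open>auto simp: W'_def\<close>)
  also have "\<dots> \<le> ?T * (n * (2064 * real k * t ^ 6 / d ^ 4))"
  proof (rule mult_left_mono)
    show "real (card Co) \<le> n * (2064 * real k * t ^ 6 / d ^ 4)"
      by (rule order_trans[OF Co mult_left_mono[OF En]]) (use n0 in simp)
  qed simp
  \<comment> \<open>1 / d^4 contributes 256 t^4 n^4 / w^4, and 528384 = 2064 * 256. The remaining
    factor 4 in the result comes from keeping only half of \<open>W\<close>.\<close>
  also have "\<dots> = 528384 * real k * n ^ 5 * t ^ 10 * ?T / w ^ 4"
    unfolding d_def using w0 t0 n0 by (simp add: field_simps power_numeral_reduce)
  finally have "w ^ 2 / 4 * w ^ 4 \<le> 528384 * real k * n ^ 5 * t ^ 10 * ?T"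
    using w0 by (simp add: pos_le_divide_eq power_divide)
  then have "w ^ 6 \<le> 2113536 * real k * n ^ 5 * t ^ 10 * ?T"
    by (simp add: power_numeral_reduce mult_ac)
  then show ?thesis unfolding w_def n_def D_def .
qed

text \<open>Each pair \<open>(y, z)\<close> gives an incidence of the point \<open>(m u, y)\<close> with the line
  \<open>c\<^sub>1 y = c\<^sub>3 z - c\<^sub>2 x / m\<close> for every slope \<open>m\<close> with \<open>u = (c\<^sub>3 z - c\<^sub>1 y) / c\<^sub>2 \<in> Q m\<close>.\<close>

lemma card_popular_solutions_le:
  fixes S H Q1 Q3 :: "real set" and T :: "(real \<times> real) set" and Q :: "real \<Rightarrow> real set" and B \<rho> c1 c2 c3 :: real and k :: nat
  assumes fin: "finite S" "finite H" "finite Q1" "finite Q3" and c: "c1 \<noteq> 0" "c2 \<noteq> 0" "c3 \<noteq> 0"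
    and S: "0 \<notin> S" and T: "T \<subseteq> Q1 \<times> Q3" and cQ: "real (card Q1) \<le> B" "real (card Q3) \<le> B"
    and B: "B > 0" "B \<le> 4 * real k * real (card H)" and k: "k > 0"
    and \<rho>: "\<rho> = real (card S) * B / (8 * real k * real (card H))"
    and Q: "\<And>m y. m \<in> S \<Longrightarrow> y \<in> Q m \<Longrightarrow> m * y \<in> H"
    and rich: "\<And>y z. (y, z) \<in> T \<Longrightarrow> \<rho> \<le> real (card {m\<in>S. (c3 * z - c1 * y) / c2 \<in> Q m})"
    and Sh: "real (card S) \<le> real (card H) ^ 3"
  shows "real (card T) ^ 3 * real (card S) \<le> 2097152 * real k ^ 4 * real (card H) ^ 6"
proof (cases "T = {} \<or> S = {}")
  case True
  then show ?thesis by auto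
next
  case False
  define \<sigma> where "\<sigma> = real (card S)"
  define h where "h = real (card H)"
  have s0: "\<sigma> > 0" unfolding \<sigma>_def using fin False by (simp add: card_gt_0_iff)
  have h0: "h > 0"
  proof (rule ccontr)
    assume "\<not> h > 0"
    then have "h = 0" unfolding h_def by simp
    then show False using B unfolding h_def by simp
  qed
  have finT: "finite T" by (rule finite_subset[OF T]) (use fin in auto)
  have k1: "real k \<ge> 1" using k by simp
  define line where "line = (\<lambda>(m, z). (- (c2 / (c1 * m)), c3 / c1 * z :: real))"
  define L where "L = line ` (S \<times> Q3)"
  have finL: "finite L" unfolding L_def using fin by auto
  have "card L \<le> card (S \<times> Q3)" unfolding L_def using fin by (intro card_image_le) auto
  then have "real (card L) \<le> real (card (S \<times> Q3))" by (rule of_nat_mono)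
  also have "\<dots> = \<sigma> * real (card Q3)" unfolding \<sigma>_def by (simp add: card_cartesian_product)
  also have "\<dots> \<le> \<sigma> * B" using cQ s0 by (intro mult_left_mono) auto
  finally have cL: "real (card L) \<le> \<sigma> * B" .
  have L0: "L \<noteq> {}" using False T unfolding L_def by auto
  let ?u = "\<lambda>x. (c3 * snd x - c1 * fst x) / c2"
  define Inc where "Inc = (SIGMA x:T. {m\<in>S. ?u x \<in> Q m})"
  define I where "I = real (card T) * \<rho>"
  have "I = (\<Sum>x\<in>T. \<rho>)" unfolding I_def by simp
  also have "\<dots> \<le> (\<Sum>x\<in>T. real (card {m\<in>S. ?u x \<in> Q m}))" using rich by (intro sum_mono) auto
  also have "\<dots> = real (card Inc)" unfolding Inc_def using finT fin by simp
  also have "card Inc \<le> card (SIGMA l:L. line_points H Q1 l)"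
  proof (rule card_inj_on_le[of "\<lambda>(x, m). (line (m, snd x), m * ?u x)"])
    show "inj_on (\<lambda>(x, m). (line (m, snd x), m * ?u x)) Inc"
    proof (rule inj_onI)
      fix v v' assume v: "v \<in> Inc" "v' \<in> Inc"
        "(case v of (x, m) \<Rightarrow> (line (m, snd x), m * ?u x)) = (case v' of (x, m) \<Rightarrow> (line (m, snd x), m * ?u x))"
      obtain x m x' m' where e: "v = (x, m)" "v' = (x', m')" by (metis prod.collapse)
      have m0: "m \<noteq> 0" "m' \<noteq> 0" using v S unfolding e Inc_def by auto
      have l: "line (m, snd x) = line (m', snd x')" "m * ?u x = m' * ?u x'" using v(3) unfolding e by auto
      have "c2 / (c1 * m) = c2 / (c1 * m')" using l(1) unfolding line_def by simp
      then have mm: "m = m'" using c m0 by (simp add: frac_eq_eq)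
      have sx: "snd x = snd x'" using l(1) c unfolding line_def by simp
      have "?u x = ?u x'" using l(2) m0 mm by simp
      then have "c3 * snd x - c1 * fst x = c3 * snd x' - c1 * fst x'" using c(2) by simp
      then have "fst x = fst x'" using sx c(1) by simp
      then show "v = v'" using e mm sx by (simp add: prod_eq_iff)
    qed
    show "(\<lambda>(x, m). (line (m, snd x), m * ?u x)) ` Inc \<subseteq> (SIGMA l:L. line_points H Q1 l)"
    proof (rule image_subsetI)
      fix v assume v: "v \<in> Inc"
      obtain y z m where e: "v = ((y, z), m)" by (metis prod.collapse)
      have m: "(y, z) \<in> T" "m \<in> S" "(c3 * z - c1 * y) / c2 \<in> Q m" "m \<noteq> 0" using v S unfolding e Inc_def by auto
      have "fst (line (m, z)) * (m * ((c3 * z - c1 * y) / c2)) + snd (line (m, z)) = y"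
        unfolding line_def using c m(4) by (simp add: field_simps)
      then have "m * ((c3 * z - c1 * y) / c2) \<in> line_points H Q1 (line (m, z))"
        unfolding line_points_def using Q[OF m(2,3)] T m(1) by auto
      moreover have "line (m, z) \<in> L" unfolding L_def using m T by auto
      ultimately show "(case v of (x, m) \<Rightarrow> (line (m, snd x), m * ?u x)) \<in> (SIGMA l:L. line_points H Q1 l)"
        unfolding e by simp
    qed
  qed (use finL fin in auto)
  also have "card (SIGMA l:L. line_points H Q1 l) = (\<Sum>l\<in>L. card (line_points H Q1 l))"
    using finL fin by simp
  finally have I: "I \<le> (\<Sum>l\<in>L. real (card (line_points H Q1 l)))" by simp
  have Ival: "I = real (card T) * (\<sigma> * B / (8 * real k * h))" unfolding I_def \<rho> \<sigma>_def h_def ..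
  \<comment> \<open>If there are too few incidences for the cubic bound, then
    \<open>real (card T) < 64 * k * h\<close> follows directly, and \<open>Sh\<close> makes this
    more than sufficient.\<close>
  show ?thesis
  proof (cases "8 * real (card L) \<le> I")
    case True
    have "I ^ 3 \<le> 1024 * (h * real (card Q1) * real (card L)) ^ 2"
      unfolding h_def
    proof (rule incidences_cubed_le[OF _ _ _ _ I True L0])
      show "fst l \<noteq> 0" if "l \<in> L" for l using that c S unfolding L_def line_def by auto
    qed (use fin finL in auto)
    also have "\<dots> \<le> 1024 * (h * B * (\<sigma> * B)) ^ 2"
      using cQ cL h0 B s0 by (intro mult_left_mono power_mono mult_mono) auto
    finally have "(real (card T) * (\<sigma> * B / (8 * real k * h))) ^ 3 \<le> 1024 * (h * B * (\<sigma> * B)) ^ 2"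
      unfolding Ival .
    moreover have "(real (card T) * (\<sigma> * B / (8 * real k * h))) ^ 3
        = (real (card T) ^ 3 * \<sigma>) * (\<sigma> ^ 2 * B ^ 3) / (512 * real k ^ 3 * h ^ 3)"
      by (simp add: power_divide power_mult_distrib power_numeral_reduce mult_ac)
    moreover have "512 * real k ^ 3 * h ^ 3 > 0" using k1 h0 by simp
    ultimately have "(real (card T) ^ 3 * \<sigma>) * (\<sigma> ^ 2 * B ^ 3) \<le> 1024 * (h * B * (\<sigma> * B)) ^ 2 * (512 * real k ^ 3 * h ^ 3)"
      by (simp add: pos_divide_le_eq)
    also have "\<dots> = (524288 * real k ^ 3 * h ^ 5 * B) * (\<sigma> ^ 2 * B ^ 3)"
      by (simp add: power_mult_distrib power_numeral_reduce mult_ac)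
    finally have "real (card T) ^ 3 * \<sigma> \<le> 524288 * real k ^ 3 * h ^ 5 * B"
      by (rule mult_right_le_imp_le) (use s0 B in auto)
    \<comment> \<open>The lower bound on incidences scales with \<open>B\<close>, so all but one
      factor \<open>B\<close> has cancelled, and the last one is bounded by the number of
      products.\<close>
    also have "\<dots> \<le> 524288 * real k ^ 3 * h ^ 5 * (4 * real k * h)"
      using B(2) h0 unfolding h_def by (intro mult_left_mono) auto
    also have "\<dots> = 2097152 * real k ^ 4 * h ^ 6" by (simp add: power_numeral_reduce mult_ac)
    finally show ?thesis unfolding \<sigma>_def h_def .
  next
    case False
    then have "real (card T) * (\<sigma> * B / (8 * real k * h)) < 8 * (\<sigma> * B)" using cL unfolding Ival by linarith
    then have "real (card T) * (\<sigma> * B) < 64 * real k * h * (\<sigma> * B)" using k1 h0 by (simp add: field_simps)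
    then have "real (card T) < 64 * real k * h" using s0 B by (simp add: mult_less_cancel_right)
    then have "real (card T) ^ 3 \<le> (64 * real k * h) ^ 3" by (intro power_mono) auto
    then have "real (card T) ^ 3 * \<sigma> \<le> (64 * real k * h) ^ 3 * h ^ 3"
      using Sh h0 s0 k1 unfolding \<sigma>_def h_def by (intro mult_mono) auto
    also have "\<dots> = 262144 * real k ^ 3 * h ^ 6" by (simp add: power_mult_distrib power_numeral_reduce mult_ac)
    also have "\<dots> \<le> 2097152 * real k ^ 4 * h ^ 6"
    proof (rule mult_right_mono)
      have "real k ^ 3 \<le> real k ^ 4" using k1 by (intro power_increasing) auto
      then show "262144 * real k ^ 3 \<le> 2097152 * real k ^ 4"
        using zero_le_power[of "real k" 4] k1 by linarith
    qed (use h0 in auto)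
    finally show ?thesis unfolding \<sigma>_def h_def .
  qed
qed

subsection \<open>The sum-product bound\<close>

lemma card_quotients:
  fixes A :: "real set"
  assumes "\<And>a. a \<in> A \<Longrightarrow> a > 0"
  shows "card {x \<in> A \<times> A. snd x / fst x = l} = card (dilation_part A l)"
proof -
  have "{x \<in> A \<times> A. snd x / fst x = l} = (\<lambda>a. (a, l * a)) ` dilation_part A l"
  proof (rule set_eqI, rule iffI)
    fix x assume x: "x \<in> {x \<in> A \<times> A. snd x / fst x = l}"
    then have "fst x > 0" using assms by auto
    then have "snd x = l * fst x" using x by auto
    then show "x \<in> (\<lambda>a. (a, l * a)) ` dilation_part A l"
      using x unfolding dilation_part_def by (intro image_eqI[of _ _ "fst x"]) (auto simp: prod_eq_iff)
  next
    fix x assume "x \<in> (\<lambda>a. (a, l * a)) ` dilation_part A l"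
    then obtain a where a: "x = (a, l * a)" "a \<in> A" "l * a \<in> A" unfolding dilation_part_def by auto
    then show "x \<in> {x \<in> A \<times> A. snd x / fst x = l}" using assms[of a] by simp
  qed
  then show ?thesis by (simp add: card_image inj_on_def)
qed

text \<open>Cauchy-Schwarz for the product map gives at least |A|^4 / |AA| solutions of ab = cd.
  Read as a / c = d / b, they are pairs of points of \<open>A \<times> A\<close> on a common line
  through the origin, so their number is the sum of the squares of
  \<open>card (dilation_part A l)\<close>; one dyadic level carries a share 1 / k of it.\<close>

lemma popular_slopes:
  fixes A :: "real set" and k :: nat
  assumes finA: "finite A" and A: "A \<noteq> {}" and Apos: "\<And>a. a \<in> A \<Longrightarrow> a > 0" and k: "card A < 2 ^ k"
  obtains S :: "real set" and \<tau> :: real where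
    "finite S" "S \<noteq> {}" "0 \<notin> S" "\<tau> \<ge> 1"
    "\<And>l. l \<in> S \<Longrightarrow> \<tau> \<le> real (card (dilation_part A l))"
    "\<And>l. l \<in> S \<Longrightarrow> real (card (dilation_part A l)) \<le> 2 * \<tau>"
    "real (card S) * \<tau> \<le> real (card A) ^ 2"
    "real (card A) ^ 4 \<le> real (card (prodset A)) * (4 * real k * real (card S) * \<tau> ^ 2)"
proof -
  define f where "f = (\<lambda>x::real\<times>real. snd x / fst x)"
  define \<Lambda> where "\<Lambda> = f ` (A \<times> A)"
  define g where "g l = card (dilation_part A l)" for l
  have fin: "finite \<Lambda>" unfolding \<Lambda>_def using finA by auto
  have fibre: "card {x \<in> A \<times> A. f x = l} = g l" for l
    unfolding f_def g_def using Apos by (rule card_quotients)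
  have n0: "card A > 0" using finA A by (simp add: card_gt_0_iff)
  have gb: "1 \<le> g l \<and> g l < 2 ^ k" if "l \<in> \<Lambda>" for l
  proof -
    have "{x \<in> A \<times> A. f x = l} \<noteq> {}" using that unfolding \<Lambda>_def by auto
    then have "card {x \<in> A \<times> A. f x = l} > 0" using finA by (simp add: card_gt_0_iff)
    moreover have "g l \<le> card A" unfolding g_def dilation_part_def using finA by (intro card_mono) auto
    ultimately show ?thesis unfolding fibre using k by linarith
  qed
  have k0: "k > 0"
  proof (rule ccontr)
    assume "\<not> k > 0"
    then show False using k n0 by simp
  qed
  obtain j where j: "(\<Sum>l\<in>\<Lambda>. real (g l) ^ 2) \<le> real k * (\<Sum>l\<in>{l\<in>\<Lambda>. 2 ^ j \<le> g l \<and> g l < 2 ^ (j + 1)}. real (g l) ^ 2)"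
    by (rule dyadic_pigeonhole[where w = "\<lambda>l. real (g l) ^ 2", OF fin k0 gb]) auto
  define S where "S = {l\<in>\<Lambda>. 2 ^ j \<le> g l \<and> g l < 2 ^ (j + 1)}"
  define \<tau> where "\<tau> = (2 ^ j :: real)"
  have S1: "\<tau> \<le> real (g l)" "real (g l) \<le> 2 * \<tau>" if "l \<in> S" for l
  proof -
    have "2 ^ j \<le> g l" "g l \<le> 2 ^ (j + 1)" using that unfolding S_def by auto
    then have "real (2 ^ j) \<le> real (g l)" "real (g l) \<le> real (2 ^ (j + 1))" by (simp_all only: of_nat_le_iff)
    then show "\<tau> \<le> real (g l)" "real (g l) \<le> 2 * \<tau>" unfolding \<tau>_def by simp_all
  qed
  have finS: "finite S" unfolding S_def using fin by auto
  let ?C = "{(x, x'). x \<in> A \<times> A \<and> x' \<in> A \<times> A \<and> fst x * snd x = fst x' * snd x'}"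
  have "(\<lambda>x. fst x * snd x) ` (A \<times> A) \<subseteq> prodset A"
  proof (rule image_subsetI)
    fix x assume "x \<in> A \<times> A"
    then have "fst x \<in> A" "snd x \<in> A" by auto
    then show "fst x * snd x \<in> prodset A" unfolding prodset_def by blast
  qed
  then have "real (card (A \<times> A)) ^ 2 \<le> real (card (prodset A)) * real (card ?C)"
    by (intro card_square_le_collisions) (use finA in auto)
  moreover have "real (card (A \<times> A)) ^ 2 = real (card A) ^ 4"
    by (simp add: card_cartesian_product power_numeral_reduce)
  ultimately have 1: "real (card A) ^ 4 \<le> real (card (prodset A)) * real (card ?C)" by simp
  have "card ?C \<le> card {(x, x'). x \<in> A \<times> A \<and> x' \<in> A \<times> A \<and> f x = f x'}"
  proof (rule card_inj_on_le[of "\<lambda>((a, b), (c, d)). ((c, a), (b, d))"])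
    show "(\<lambda>((a, b), (c, d)). ((c, a), (b, d))) ` ?C \<subseteq> {(x, x'). x \<in> A \<times> A \<and> x' \<in> A \<times> A \<and> f x = f x'}"
    proof (rule image_subsetI)
      fix z assume z: "z \<in> ?C"
      then obtain a b c d where e: "z = ((a, b), (c, d))" "a \<in> A" "b \<in> A" "c \<in> A" "d \<in> A" "a * b = c * d" by auto
      have "b > 0" "c > 0" using e Apos by auto
      then have "a / c = d / b" using e(6) by (simp add: frac_eq_eq mult.commute)
      then show "(\<lambda>((a, b), (c, d)). ((c, a), (b, d))) z \<in> {(x, x'). x \<in> A \<times> A \<and> x' \<in> A \<times> A \<and> f x = f x'}"
        using e unfolding f_def by auto
    qed
    show "inj_on (\<lambda>((a, b), (c, d)). ((c, a), (b, d))) ?C" by (auto simp: inj_on_def)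
    show "finite {(x, x'). x \<in> A \<times> A \<and> x' \<in> A \<times> A \<and> f x = f x'}"
      by (rule finite_subset[of _ "(A \<times> A) \<times> (A \<times> A)"]) (use finA in auto)
  qed
  also have "card {(x, x'). x \<in> A \<times> A \<and> x' \<in> A \<times> A \<and> f x = f x'} = (\<Sum>l\<in>\<Lambda>. card {x \<in> A \<times> A. f x = l} ^ 2)"
    by (rule card_collisions_eq_sum) (use finA fin in \<open>auto simp: \<Lambda>_def\<close>)
  also have "\<dots> = (\<Sum>l\<in>\<Lambda>. g l ^ 2)" unfolding fibre ..
  finally have "real (card ?C) \<le> real (\<Sum>l\<in>\<Lambda>. g l ^ 2)" by (rule of_nat_mono)
  also have "\<dots> = (\<Sum>l\<in>\<Lambda>. real (g l) ^ 2)" by simp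
  also have "\<dots> \<le> real k * (\<Sum>l\<in>S. real (g l) ^ 2)" using j unfolding S_def .
  also have "\<dots> \<le> real k * (\<Sum>l\<in>S. (2 * \<tau>) ^ 2)"
    using S1 by (intro mult_left_mono sum_mono power_mono) auto
  also have "\<dots> = 4 * real k * real (card S) * \<tau> ^ 2" by simp
  finally have "real (card (prodset A)) * real (card ?C) \<le> real (card (prodset A)) * (4 * real k * real (card S) * \<tau> ^ 2)"
    by (rule mult_left_mono) simp
  with 1 have E: "real (card A) ^ 4 \<le> real (card (prodset A)) * (4 * real k * real (card S) * \<tau> ^ 2)" by linarith
  have Sne: "S \<noteq> {}"
  proof
    assume "S = {}"
    then have "real (card A) ^ 4 \<le> 0" using E by simp
    then show False using n0 by simp
  qed
  have S0: "0 \<notin> S"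
  proof
    assume "0 \<in> S"
    then obtain x where "x \<in> A \<times> A" "snd x / fst x = 0" unfolding S_def \<Lambda>_def f_def by auto
    then show False using Apos[of "fst x"] Apos[of "snd x"] by auto
  qed
  have St: "real (card S) * \<tau> \<le> real (card A) ^ 2"
  proof -
    have "real (card S) * \<tau> = (\<Sum>l\<in>S. \<tau>)" by simp
    also have "\<dots> \<le> (\<Sum>l\<in>S. real (g l))" using S1 by (intro sum_mono) auto
    also have "\<dots> \<le> (\<Sum>l\<in>\<Lambda>. real (g l))" using fin by (intro sum_mono2) (auto simp: S_def)
    also have "\<dots> = real (\<Sum>l\<in>\<Lambda>. card {x \<in> A \<times> A. f x = l})" unfolding fibre by simp
    also have "(\<Sum>l\<in>\<Lambda>. card {x \<in> A \<times> A. f x = l}) = card (A \<times> A)"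
      by (rule card_eq_sum_fibres[symmetric]) (use finA fin in \<open>auto simp: \<Lambda>_def\<close>)
    finally show ?thesis by (simp add: card_cartesian_product power2_eq_square)
  qed
  show thesis
    by (rule that[OF finS Sne S0 _ _ _ St E]) (use S1 in \<open>auto simp: g_def \<tau>_def\<close>)
qed

lemma card_le_card_prodset:
  fixes A :: "real set"
  assumes "finite A" "\<And>a. a \<in> A \<Longrightarrow> a > 0"
  shows "card A \<le> card (prodset A)"
proof (cases "A = {}")
  case False
  then obtain b where b: "b \<in> A" by auto
  have "inj_on ((*) b) A" using assms(2)[OF b] by (auto simp: inj_on_def)
  moreover have "(*) b ` A \<subseteq> prodset A" using b unfolding prodset_def by auto
  ultimately show ?thesis by (rule card_inj_on_le) (use assms in auto)
qed simp

text \<open>\<open>M\<close> is an upper bound rather than the maximum itself, so that it can be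
  enlarged until \<open>z = M ^ 3 / n ^ 4\<close> is at least 1. The number \<open>k\<close> plays
  the part of the logarithm of \<open>card A\<close>.\<close>

lemma sum_product_power_bound:
  obtains C :: real where "C \<ge> 1"
    "\<And>(A::real set) (k::nat) (M::real). \<lbrakk>finite A; A \<noteq> {}; \<And>a. a \<in> A \<Longrightarrow> a > 0; 2 * card A < 2 ^ k;
       real (card (sumset A)) \<le> M; real (card (prodset A)) \<le> M; real (card A) ^ 4 \<le> M ^ 3\<rbrakk> \<Longrightarrow>
       real (card A) ^ 159 \<le> C * real k ^ 156 * M ^ 119"
proof -
  \<comment> \<open>\<open>c\<close> comes from the cubed bound on dilates, where
    \<open>(2 * \<tau>) ^ 10\<close> leaves 2^30, times the incidence constant. \<open>e\<close> is
    16 * 2^2 * 273^2, from \<open>16 * L ^ 2 * real N ^ 2\<close>. The first entry of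
    \<open>C\<close> is for the case of few slopes.\<close>
  define c where "c = (2113536 ^ 3 * 2 ^ 30 * 2097152 :: real)"
  define e where "e = (64 * 273 ^ 2 :: real)"
  define C where "C = max (1092 ^ 26) (c * e ^ 18 * 4 ^ 5)"
  have "C \<ge> 1" unfolding C_def by simp
  moreover have "real (card A) ^ 159 \<le> C * real k ^ 156 * M ^ 119"
    if finA: "finite A" and A: "A \<noteq> {}" and Apos: "\<And>a. a \<in> A \<Longrightarrow> a > 0" and k: "2 * card A < 2 ^ k"
      and MU: "real (card (sumset A)) \<le> M" and Mh: "real (card (prodset A)) \<le> M" and Mn: "real (card A) ^ 4 \<le> M ^ 3"
    for A :: "real set" and k :: nat and M :: real
  proof -
    define n where "n = real (card A)"
    define U where "U = real (card (sumset A))"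
    define h where "h = real (card (prodset A))"
    have n1: "n \<ge> 1" unfolding n_def using finA A by (simp add: Suc_le_eq card_gt_0_iff)
    have nh: "n \<le> h" unfolding n_def h_def using card_le_card_prodset[OF finA Apos] by simp
    have hM: "h \<le> M" and UM: "U \<le> M" using Mh MU unfolding h_def U_def by auto
    have M1: "M \<ge> 1" "n \<le> M" using n1 nh hM by linarith+
    have k1: "real k \<ge> 1"
    proof -
      have "k \<noteq> 0" using k n1 unfolding n_def by (intro notI) simp
      then show ?thesis by simp
    qed
    have kn: "card A < 2 ^ k" using k by linarith
    from popular_slopes[OF finA A Apos kn] obtain S \<tau> where
      finS: "finite S" and S: "S \<noteq> {}" and S0: "0 \<notin> S" and \<tau>1: "\<tau> \<ge> 1"
      and \<tau>lo: "\<And>l. l \<in> S \<Longrightarrow> \<tau> \<le> real (card (dilation_part A l))"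
      and \<tau>hi: "\<And>l. l \<in> S \<Longrightarrow> real (card (dilation_part A l)) \<le> 2 * \<tau>"
      and St: "real (card S) * \<tau> \<le> n ^ 2"
      and E: "n ^ 4 \<le> h * (4 * real k * real (card S) * \<tau> ^ 2)"
      unfolding n_def h_def by blast
    define \<sigma> where "\<sigma> = real (card S)"
    have s1: "\<sigma> \<ge> 1" unfolding \<sigma>_def using finS S by (simp add: Suc_le_eq card_gt_0_iff)
    have \<tau>n: "\<tau> \<le> n"
    proof -
      obtain l where l: "l \<in> S" using S by auto
      have "card (dilation_part A l) \<le> card A" unfolding dilation_part_def using finA by (intro card_mono) auto
      then show ?thesis using \<tau>lo[OF l] unfolding n_def by linarith
    qed
    have tk: "2 * \<tau> < 2 ^ k"
    proof -
      have "real (2 * card A) < real (2 ^ k)" using k by (simp only: of_nat_less_iff)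
      then show ?thesis using \<tau>n unfolding n_def by simp
    qed
    have kp: "k > 0" using k1 by simp
    have E': "n ^ 4 \<le> 4 * real k * M * (\<sigma> * \<tau> ^ 2)"
    proof -
      have "n ^ 4 \<le> h * (4 * real k * \<sigma> * \<tau> ^ 2)" using E unfolding \<sigma>_def .
      also have "\<dots> \<le> M * (4 * real k * \<sigma> * \<tau> ^ 2)" using hM k1 s1 by (intro mult_right_mono) auto
      finally show ?thesis by (simp add: mult_ac)
    qed
    define z where "z = M ^ 3 / n ^ 4"
    have z1: "z \<ge> 1" unfolding z_def using Mn n1 unfolding n_def by (simp add: le_divide_eq)
    define L where "L = 2 * real k"
    \<comment> \<open>The sum meets both size conditions on blocks. In \<open>Nub\<close>, 273 = 256
      + 17: the main term is at most 256 k^3 z by \<open>E'\<close>, and 8 L plus rounding at most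
      17 k^3 z.\<close>
    define N where "N = nat \<lceil>8 * L + 16 * L ^ 2 * U ^ 2 / (\<sigma> * \<tau> ^ 2)\<rceil>"
    have NL: "8 * L + 16 * L ^ 2 * U ^ 2 / (\<sigma> * \<tau> ^ 2) \<le> real N" unfolding N_def by linarith
    have fpos: "16 * L ^ 2 * U ^ 2 / (\<sigma> * \<tau> ^ 2) \<ge> 0" using s1 by simp
    have L2: "L \<ge> 2" unfolding L_def using k1 by simp
    have N8: "8 * L \<le> real N" and N16: "16 * L ^ 2 * U ^ 2 / (\<sigma> * \<tau> ^ 2) \<le> real N" using NL fpos L2 by linarith+
    have Nub: "real N \<le> 273 * real k ^ 3 * z"
    proof -
      have "real N \<le> 8 * L + 16 * L ^ 2 * U ^ 2 / (\<sigma> * \<tau> ^ 2) + 1"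
        unfolding N_def using fpos L2 by linarith
      moreover have "16 * L ^ 2 * U ^ 2 / (\<sigma> * \<tau> ^ 2) \<le> 256 * real k ^ 3 * z"
      proof -
        have st: "\<sigma> * \<tau> ^ 2 > 0" using s1 \<tau>1 by simp
        have "64 * real k ^ 2 * U ^ 2 * n ^ 4 \<le> 64 * real k ^ 2 * M ^ 2 * (4 * real k * M * (\<sigma> * \<tau> ^ 2))"
          using E' UM n1 unfolding U_def by (intro mult_mono power_mono) auto
        also have "\<dots> = 256 * real k ^ 3 * M ^ 3 * (\<sigma> * \<tau> ^ 2)" by (simp add: power_numeral_reduce)
        finally have "64 * real k ^ 2 * U ^ 2 / (\<sigma> * \<tau> ^ 2) \<le> 256 * real k ^ 3 * (M ^ 3 / n ^ 4)"
          using st n1 by (simp add: field_simps)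
        then show ?thesis unfolding L_def z_def by simp
      qed
      moreover have "8 * L + 1 \<le> 17 * real k ^ 3 * z"
      proof -
        have "real k \<le> real k ^ 3" using k1 by (simp add: self_le_power)
        also have "\<dots> \<le> real k ^ 3 * z" using z1 k1 by simp
        finally show ?thesis unfolding L_def using k1 by linarith
      qed
      ultimately show ?thesis by linarith
    qed
    show ?thesis
    proof (cases "N \<le> card S")
      \<comment> \<open>So few slopes can carry the energy only if each has many points. This gives
        n^6 <= 1092 k^4 M^4, that is exponent 3/2; the power 26 and the factor n^3 <= M^3 merely
        bring it into the common shape.\<close>
      case False
      have "n ^ 4 \<le> 4 * real k * M * (\<sigma> * n ^ 2)"
        by (rule order_trans[OF E']) (use \<tau>n \<tau>1 k1 M1 s1 in \<open>intro mult_left_mono power_mono; simp\<close>)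
      then have "n ^ 2 * n ^ 2 \<le> (4 * real k * M * \<sigma>) * n ^ 2" by (simp add: power_numeral_reduce mult_ac)
      then have n2: "n ^ 2 \<le> 4 * real k * M * \<sigma>"
        by (rule mult_right_le_imp_le) (use n1 in auto)
      have "\<sigma> \<le> 273 * real k ^ 3 * z" using False Nub unfolding \<sigma>_def by linarith
      then have "4 * real k * M * \<sigma> \<le> 4 * real k * M * (273 * real k ^ 3 * z)"
        using k1 M1 by (intro mult_left_mono) auto
      then have "n ^ 2 \<le> 4 * real k * M * (273 * real k ^ 3 * z)" using n2 by linarith
      also have "\<dots> = 1092 * real k ^ 4 * M ^ 4 / n ^ 4" unfolding z_def by (simp add: power_numeral_reduce)
      finally have "n ^ 6 \<le> 1092 * real k ^ 4 * M ^ 4"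
        using n1 by (simp add: pos_le_divide_eq flip: power_add)
      then have "(n ^ 6) ^ 26 \<le> (1092 * real k ^ 4 * M ^ 4) ^ 26" using n1 by (intro power_mono) auto
      moreover have "n ^ 3 \<le> M ^ 3" using n1 M1 by (intro power_mono) auto
      ultimately have "(n ^ 6) ^ 26 * n ^ 3 \<le> (1092 * real k ^ 4 * M ^ 4) ^ 26 * M ^ 3"
        by (rule mult_mono) (use n1 M1 in auto)
      also have "(n ^ 6) ^ 26 * n ^ 3 = n ^ 159" by (simp flip: power_mult power_add)
      also have "(1092 * real k ^ 4 * M ^ 4) ^ 26 * M ^ 3 = 1092 ^ 26 * real k ^ 104 * M ^ 107"
        unfolding power_mult_distrib power_mult[symmetric] by (simp add: mult.assoc power_add[symmetric])
      also have "\<dots> \<le> C * real k ^ 156 * M ^ 119"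
        using k1 M1 unfolding C_def by (intro mult_mono power_increasing max.cobounded1) auto
      finally show ?thesis unfolding n_def .
    next
      case True
      have \<tau>p: "\<tau> > 0" using \<tau>1 by simp
      from regular_products[OF finA A Apos finS S \<tau>p \<tau>lo \<tau>hi tk kp]
      obtain B \<rho> Q G where
        B: "B > 0" "B \<le> 4 * real k * real (card (prodset A))"
        and \<rho>: "\<rho> = real (card S) * B / (8 * real k * real (card (prodset A)))"
        and Q: "\<And>l. l \<in> S \<Longrightarrow> finite (Q l) \<and> real (card (Q l)) \<le> B"
        and Qp: "\<And>l y. l \<in> S \<Longrightarrow> y \<in> Q l \<Longrightarrow> l * y \<in> prodset A"
        and G: "\<And>l. l \<in> S \<Longrightarrow> G l \<subseteq> A \<times> dilation_part A l"
        and GQ: "\<And>l a p. l \<in> S \<Longrightarrow> (a, p) \<in> G l \<Longrightarrow> a * p \<in> Q l \<and> \<rho> \<le> real (card {m\<in>S. a * p \<in> Q m})"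
        and Gs: "real (card A) * \<tau> * real (card S) / (2 * real k) \<le> (\<Sum>l\<in>S. real (card (G l)))"
        by blast
      have L1: "L \<ge> 1" using L2 by simp
      from slope_collisions[OF finA A Apos finS S \<tau>p \<tau>hi G L1 Gs[folded L_def] True N8 N16[unfolded U_def \<sigma>_def]]
      obtain l1 l2 l3 l4 where l: "l1 \<in> S" "l2 \<in> S" "l3 \<in> S" "l4 \<in> S" and ne: "l4 \<noteq> l1" "l4 \<noteq> l2" "l4 \<noteq> l3"
        and W0: "real (card A) * \<tau> ^ 2 / (16 * L ^ 2 * real N ^ 2)
          \<le> real (card {(a, p, q). (a, p) \<in> G l1 \<and> (a, q) \<in> G l3 \<and>
                      (a, ((l3 - l4) * q - (l1 - l4) * p) / (l2 - l4)) \<in> G l2})"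
        by blast
      define W where "W = {(a, p, q). (a, p) \<in> G l1 \<and> (a, q) \<in> G l3 \<and>
                      (a, ((l3 - l4) * q - (l1 - l4) * p) / (l2 - l4)) \<in> G l2}"
      define w where "w = real (card W)"
      define T where "T = (\<lambda>(a, p, q). (a * p, a * q)) ` W"
      define x where "x = real (card T)"
      have ws: "w ^ 6 \<le> 2113536 * real k * n ^ 5 * (2 * \<tau>) ^ 10 * x"
        unfolding w_def x_def T_def W_def n_def
        by (rule card_dilates_ge[OF finA Apos]) (use G \<tau>hi l \<tau>1 tk ne in auto)
      have xs: "x ^ 3 * \<sigma> \<le> 2097152 * real k ^ 4 * h ^ 6"
        unfolding x_def \<sigma>_def h_def
      proof (rule card_popular_solutions_le[where Q = Q and ?c1.0 = "l1 - l4" and ?c2.0 = "l2 - l4" and ?c3.0 = "l3 - l4",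
            OF finS _ _ _ _ _ _ S0 _ _ _ B kp \<rho> Qp])
        show "T \<subseteq> Q l1 \<times> Q l3" unfolding T_def W_def using GQ l by auto
        show "\<rho> \<le> real (card {m\<in>S. ((l3 - l4) * z - (l1 - l4) * y) / (l2 - l4) \<in> Q m})" if yz: "(y, z) \<in> T" for y z
        proof -
          obtain a p q where a: "(a, ((l3 - l4) * q - (l1 - l4) * p) / (l2 - l4)) \<in> G l2" "y = a * p" "z = a * q"
            using yz unfolding T_def W_def by auto
          have "((l3 - l4) * z - (l1 - l4) * y) / (l2 - l4) = a * (((l3 - l4) * q - (l1 - l4) * p) / (l2 - l4))"
            unfolding a(2,3) by (simp add: algebra_simps)
          then show ?thesis using GQ[OF l(2) a(1)] by (simp only:)
        qed
        show "real (card S) \<le> real (card (prodset A)) ^ 3"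
        proof -
          have "\<sigma> * 1 \<le> \<sigma> * \<tau>" using \<tau>1 s1 by (intro mult_left_mono) auto
          then have "\<sigma> \<le> n ^ 2" using St unfolding \<sigma>_def by linarith
          also have "\<dots> \<le> n ^ 3" using n1 by (intro power_increasing) auto
          also have "\<dots> \<le> h ^ 3" using nh n1 by (intro power_mono) auto
          finally show ?thesis unfolding \<sigma>_def h_def .
        qed
      qed (use Q l ne finA in auto)
      define D where "D = e * real k ^ 8 * z ^ 2"
      have e0: "e > 0" unfolding e_def by simp
      have D0: "D > 0" unfolding D_def using e0 k1 z1 by simp
      have NN: "16 * L ^ 2 * real N ^ 2 \<le> D"
      proof -
        have "real N ^ 2 \<le> (273 * real k ^ 3 * z) ^ 2" using Nub by (intro power_mono) auto
        then have "16 * L ^ 2 * real N ^ 2 \<le> 16 * L ^ 2 * (273 * real k ^ 3 * z) ^ 2" by (intro mult_left_mono) auto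
        also have "\<dots> = D" unfolding D_def L_def e_def by (simp add: power_mult_distrib power_numeral_reduce)
        finally show ?thesis .
      qed
      have Np: "16 * L ^ 2 * real N ^ 2 > 0" using L2 N8 by simp
      have "n * \<tau> ^ 2 / D \<le> n * \<tau> ^ 2 / (16 * L ^ 2 * real N ^ 2)"
        using NN Np n1 by (intro divide_left_mono) (auto intro: mult_pos_pos D0)
      also have "\<dots> \<le> w" using W0 unfolding w_def W_def n_def .
      finally have "n * \<tau> ^ 2 \<le> D * w" using D0 by (simp add: pos_divide_le_eq mult.commute)
      \<comment> \<open>The power 18 makes w^6 appear cubed, so that \<open>ws\<close> produces x^3,
        the power of x that \<open>xs\<close> bounds.\<close>
      then have "(n * \<tau> ^ 2) ^ 18 \<le> (D * w) ^ 18" using n1 by (intro power_mono) auto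
      also have "\<dots> = D ^ 18 * (w ^ 6) ^ 3" by (simp add: power_mult_distrib flip: power_mult)
      also have "\<dots> \<le> D ^ 18 * (2113536 * real k * n ^ 5 * (2 * \<tau>) ^ 10 * x) ^ 3"
        using ws D0 by (intro mult_left_mono power_mono) (auto simp: w_def)
      finally have "(n * \<tau> ^ 2) ^ 18 * \<sigma> \<le> D ^ 18 * (2113536 * real k * n ^ 5 * (2 * \<tau>) ^ 10 * x) ^ 3 * \<sigma>"
        using s1 by (intro mult_right_mono) auto
      also have "\<dots> = D ^ 18 * (2113536 ^ 3 * 2 ^ 30) * real k ^ 3 * n ^ 15 * \<tau> ^ 30 * (x ^ 3 * \<sigma>)"
        by (simp add: power_mult_distrib flip: power_mult)
      also have "\<dots> \<le> D ^ 18 * (2113536 ^ 3 * 2 ^ 30) * real k ^ 3 * n ^ 15 * \<tau> ^ 30 * (2097152 * real k ^ 4 * M ^ 6)"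
      proof (rule mult_left_mono)
        have "2097152 * real k ^ 4 * h ^ 6 \<le> 2097152 * real k ^ 4 * M ^ 6"
          using hM nh n1 by (intro mult_left_mono power_mono) auto
        then show "x ^ 3 * \<sigma> \<le> 2097152 * real k ^ 4 * M ^ 6" using xs by linarith
      qed (use D0 n1 \<tau>1 in auto)
      also have "\<dots> = (c * D ^ 18 * real k ^ 7 * M ^ 6) * (n ^ 15 * \<tau> ^ 30)"
        unfolding c_def by (simp add: power_numeral_reduce)
      also have "(n * \<tau> ^ 2) ^ 18 * \<sigma> = (n ^ 3 * (\<sigma> * \<tau> ^ 2) * \<tau> ^ 4) * (n ^ 15 * \<tau> ^ 30)"
        by (simp add: power_mult_distrib power_numeral_reduce mult_ac)
      finally have "n ^ 3 * (\<sigma> * \<tau> ^ 2) * \<tau> ^ 4 \<le> c * D ^ 18 * real k ^ 7 * M ^ 6"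
        by (rule mult_right_le_imp_le) (use n1 \<tau>p in auto)
      \<comment> \<open>One factor \<open>4 * real k * M\<close> will pay for replacing
        \<open>\<sigma> * \<tau> ^ 2\<close> by n^4, the other four for replacing
        \<open>\<tau> ^ 4\<close> by n^8.\<close>
      then have main: "n ^ 3 * (\<sigma> * \<tau> ^ 2) * \<tau> ^ 4 * (4 * real k * M) ^ 5 \<le> c * D ^ 18 * real k ^ 7 * M ^ 6 * (4 * real k * M) ^ 5"
        by (rule mult_right_mono) (use k1 M1 in auto)
      have \<tau>low: "n ^ 2 \<le> 4 * real k * M * \<tau>"
      proof -
        have "\<sigma> * \<tau> ^ 2 \<le> n ^ 2 * \<tau>" using mult_right_mono[OF St, of \<tau>] \<tau>1 unfolding \<sigma>_def by (simp add: power2_eq_square)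
        then have "4 * real k * M * (\<sigma> * \<tau> ^ 2) \<le> 4 * real k * M * (n ^ 2 * \<tau>)"
          using k1 M1 by (intro mult_left_mono) auto
        then have "n ^ 4 \<le> 4 * real k * M * (n ^ 2 * \<tau>)" using E' by linarith
        then have "n ^ 2 * n ^ 2 \<le> (4 * real k * M * \<tau>) * n ^ 2" by (simp add: power_numeral_reduce mult_ac)
        then show ?thesis by (rule mult_right_le_imp_le) (use n1 in auto)
      qed
      have "n ^ 15 = n ^ 3 * n ^ 4 * (n ^ 2) ^ 4" by (simp flip: power_mult power_add)
      also have "\<dots> \<le> n ^ 3 * (4 * real k * M * (\<sigma> * \<tau> ^ 2)) * (4 * real k * M * \<tau>) ^ 4"
        using E' \<tau>low n1 k1 M1 s1 by (intro mult_mono power_mono) auto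
      also have "\<dots> = n ^ 3 * (\<sigma> * \<tau> ^ 2) * \<tau> ^ 4 * (4 * real k * M) ^ 5"
        by (simp add: power_mult_distrib power_numeral_reduce mult_ac)
      finally have n15: "n ^ 15 \<le> c * D ^ 18 * real k ^ 7 * M ^ 6 * (4 * real k * M) ^ 5" using main by linarith
      \<comment> \<open>\<open>D ^ 18\<close> contains z^36; multiplying by n^144 turns this into
        M^108. The power of k is 156 = 144 + 7 + 5.\<close>
      have "n ^ 159 = n ^ 15 * (n ^ 4) ^ 36" by (simp flip: power_mult power_add)
      also have "\<dots> \<le> c * D ^ 18 * real k ^ 7 * M ^ 6 * (4 * real k * M) ^ 5 * (n ^ 4) ^ 36"
        using n15 by (rule mult_right_mono) (use n1 in auto)
      also have "\<dots> = c * e ^ 18 * 4 ^ 5 * (real k ^ 144 * real k ^ 7 * real k ^ 5) * (M ^ 6 * M ^ 5) * (z * n ^ 4) ^ 36"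
        unfolding D_def power_mult_distrib power_mult[symmetric] by (simp add: mult_ac)
      also have "z * n ^ 4 = M ^ 3" unfolding z_def using n1 by simp
      also have "c * e ^ 18 * 4 ^ 5 * (real k ^ 144 * real k ^ 7 * real k ^ 5) * (M ^ 6 * M ^ 5) * (M ^ 3) ^ 36
          = c * e ^ 18 * 4 ^ 5 * real k ^ 156 * M ^ 119"
        by (simp add: mult.assoc flip: power_mult power_add)
      also have "\<dots> \<le> C * real k ^ 156 * M ^ 119"
        using k1 M1 unfolding C_def by (intro mult_right_mono max.cobounded2) auto
      finally show ?thesis unfolding n_def .
    qed
  qed
  ultimately show thesis by (rule that)
qed

section \<open>Absorbing the logarithms\<close>

lemma dyadic_exponent_exists:
  fixes \<eta> :: real
  assumes "\<eta> > 0"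
  obtains D :: real where "D \<ge> 1" "\<And>n::nat. n \<ge> 1 \<Longrightarrow> \<exists>k::nat. 2 * n < 2 ^ k \<and> real k \<le> D * real n powr \<eta>"
proof -
  define D where "D = 1 / (\<eta> * ln 2) + 2"
  have D: "D \<ge> 1" unfolding D_def using assms by simp
  have "\<exists>k::nat. 2 * n < 2 ^ k \<and> real k \<le> D * real n powr \<eta>" if n: "n \<ge> 1" for n :: nat
  proof -
    define k where "k = nat \<lfloor>log 2 (real n)\<rfloor> + 2"
    have l0: "log 2 (real n) \<ge> 0" using n by simp
    then have k: "log 2 (real n) + 1 < real k" "real k \<le> log 2 (real n) + 2" unfolding k_def by linarith+
    have "real n = 2 powr (log 2 (real n))" using n by simp
    also have "\<dots> < 2 powr (real k - 1)" using k by simp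
    also have "\<dots> = 2 ^ k / 2" by (simp add: powr_diff powr_realpow)
    finally have "real (2 * n) < real (2 ^ k)" by simp
    then have "2 * n < 2 ^ k" by (simp only: of_nat_less_iff)
    moreover have "real k \<le> D * real n powr \<eta>"
    proof -
      have "ln (real n) \<le> real n powr \<eta> / \<eta>" using n assms by (intro ln_powr_bound) auto
      then have "log 2 (real n) \<le> real n powr \<eta> / \<eta> / ln 2"
        unfolding log_def by (intro divide_right_mono) auto
      moreover have "1 \<le> real n powr \<eta>" using n assms by (intro ge_one_powr_ge_zero) auto
      ultimately show ?thesis unfolding D_def using k(2) by (simp add: distrib_right)
    qed
    ultimately show ?thesis by blast
  qed
  then show thesis using that D by blast
qed

text \<open>The exponent 159/119 leaves room for the factor k^156: with k <= D n^(1/2600) it costs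
  n^(3/50), and 159 - 3/50 = 158.94 still exceeds 119 (4/3 + 10/4407), which is about
  158.937.\<close>

lemma sum_product_positive:
  obtains c :: real where "c > 0"
    "\<And>A::real set. \<lbrakk>finite A; A \<noteq> {}; \<And>a. a \<in> A \<Longrightarrow> a > 0\<rbrakk> \<Longrightarrow>
       c * real (card A) powr (4/3 + 10/4407) \<le> real (max (card (sumset A)) (card (prodset A)))"
proof -
  obtain C where C: "C \<ge> 1"
    "\<And>(A::real set) (k::nat) (M::real). \<lbrakk>finite A; A \<noteq> {}; \<And>a. a \<in> A \<Longrightarrow> a > 0; 2 * card A < 2 ^ k;
       real (card (sumset A)) \<le> M; real (card (prodset A)) \<le> M; real (card A) ^ 4 \<le> M ^ 3\<rbrakk> \<Longrightarrow>
       real (card A) ^ 159 \<le> C * real k ^ 156 * M ^ 119"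
    using sum_product_power_bound by blast
  obtain D where D: "D \<ge> 1" "\<And>n::nat. n \<ge> 1 \<Longrightarrow> \<exists>k::nat. 2 * n < 2 ^ k \<and> real k \<le> D * real n powr (1/2600)"
    using dyadic_exponent_exists[of "1/2600"] by auto
  define F where "F = C * D ^ 156"
  have F1: "F \<ge> 1"
  proof -
    have "1 * 1 \<le> C * D ^ 156" using C(1) D(1) by (intro mult_mono one_le_power) auto
    then show ?thesis unfolding F_def by simp
  qed
  have "1 / F ^ 2 * real (card A) powr (4/3 + 10/4407) \<le> real (max (card (sumset A)) (card (prodset A)))"
    if finA: "finite A" and A: "A \<noteq> {}" and Apos: "\<And>a. a \<in> A \<Longrightarrow> a > 0" for A :: "real set"
  proof -
    define n where "n = real (card A)"
    define M0 where "M0 = real (max (card (sumset A)) (card (prodset A)))"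
    \<comment> \<open>The enlargement secures n^4 <= M^3. Where it takes effect, the power bound
      forces n^(3/11) <= F, since 159 - 3/50 - 476/3 > 3/11; then n is bounded and
      \<open>n \<le> M0\<close> suffices at the cost of F^2.\<close>
    define M where "M = max M0 (n powr (4/3))"
    have c1: "card A \<ge> 1" using finA A by (simp add: Suc_le_eq card_gt_0_iff)
    have n1: "n \<ge> 1" unfolding n_def using c1 by simp
    have nM: "n \<le> M0" unfolding n_def M0_def using card_le_card_prodset[OF finA Apos] by simp
    have M1: "M0 \<ge> 1" "M \<ge> 1" using n1 nM unfolding M_def by linarith+
    obtain k :: nat where k: "2 * card A < 2 ^ k" "real k \<le> D * n powr (1/2600)"
      using D(2)[OF c1] unfolding n_def by blast
    have "n ^ 4 \<le> M ^ 3"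
    proof -
      have "n ^ 4 = (n powr (4/3)) ^ 3" using n1 by (simp add: powr_power)
      also have "\<dots> \<le> M ^ 3" unfolding M_def by (intro power_mono) auto
      finally show ?thesis .
    qed
    moreover have "real (card (sumset A)) \<le> M" "real (card (prodset A)) \<le> M"
      unfolding M_def M0_def by simp_all
    ultimately have "n ^ 159 \<le> C * real k ^ 156 * M ^ 119"
      unfolding n_def using C(2)[OF finA A Apos k(1)] by blast
    also have "\<dots> \<le> C * (D * n powr (1/2600)) ^ 156 * M ^ 119"
      using k(2) C(1) M1 by (intro mult_right_mono mult_left_mono power_mono) auto
    also have "\<dots> = F * n powr (3/50) * M ^ 119"
      unfolding F_def power_mult_distrib using n1 by (simp add: powr_power)
    finally have main: "n powr 159 \<le> F * n powr (3/50) * M ^ 119" using n1 by simp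
    show ?thesis
    proof (cases "n powr (4/3) \<le> M0")
      case True
      then have "M = M0" unfolding M_def by simp
      have "n powr (158 + 47/50) * n powr (3/50) \<le> (F * M0 ^ 119) * n powr (3/50)"
        using main unfolding \<open>M = M0\<close> by (simp add: mult_ac flip: powr_add)
      then have 1: "n powr (158 + 47/50) \<le> F * M0 ^ 119"
        by (rule mult_right_le_imp_le) (use n1 in auto)
      have "(n powr (4/3 + 10/4407)) ^ 119 = n powr (119 * (4/3 + 10/4407))"
        using n1 by (simp add: powr_power)
      also have "\<dots> \<le> n powr (158 + 47/50)" using n1 by (intro powr_mono) auto
      also have "\<dots> \<le> F * M0 ^ 119" by (rule 1)
      \<comment> \<open>Raising F to an exact power 238 = 2 * 119 allows the 119th root to be taken,
        with the same constant F^2 as in the other case.\<close>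
      also have "\<dots> \<le> F ^ 238 * M0 ^ 119"
        using F1 M1 self_le_power[of F 238] by (intro mult_right_mono) auto
      also have "\<dots> = (F ^ 2 * M0) ^ 119" by (simp add: power_mult_distrib flip: power_mult)
      finally have "n powr (4/3 + 10/4407) \<le> F ^ 2 * M0"
        by (rule power_le_imp_le_base[where n = 118, unfolded Suc_numeral[symmetric], simplified]) (use F1 M1 in auto)
      then show ?thesis using F1 unfolding n_def M0_def by (simp add: pos_divide_le_eq mult.commute)
    next
      case False
      then have "M = n powr (4/3)" unfolding M_def by simp
      then have "M ^ 119 = n powr (476/3)" using n1 by (simp add: powr_power)
      then have "n powr (3/11) * n powr (3/50 + 476/3) \<le> F * n powr (3/50 + 476/3)"
      proof -
        assume e: "M ^ 119 = n powr (476/3)"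
        have "n powr (3/11) * n powr (3/50 + 476/3) \<le> n powr 159"
          unfolding powr_add[symmetric] using n1 by (intro powr_mono) auto
        also have "\<dots> \<le> F * n powr (3/50 + 476/3)" using main unfolding e by (simp only: powr_add mult.assoc)
        finally show ?thesis .
      qed
      then have nF: "n powr (3/11) \<le> F" by (rule mult_right_le_imp_le) (use n1 in auto)
      have "n powr (4/3 + 10/4407) \<le> n powr (1 + 6/11)" using n1 by (intro powr_mono) auto
      also have "\<dots> = n powr 1 * n powr (6/11)" by (rule powr_add)
      also have "\<dots> = n * (n powr (3/11)) ^ 2" using n1 by (simp add: powr_power)
      also have "\<dots> \<le> M0 * F ^ 2" using nM nF n1 by (intro mult_mono power_mono) auto
      finally show ?thesis using F1 unfolding n_def M0_def by (simp add: pos_divide_le_eq)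
    qed
  qed
  then show thesis using that[of "1 / F ^ 2"] F1 by simp
qed

section \<open>From positive sets to arbitrary finite sets\<close>

lemma card_sumset_uminus: "card (sumset (uminus ` A)) = card (sumset A)"
proof -
  have "sumset (uminus ` A) = uminus ` sumset A"
  proof (rule set_eqI, rule iffI)
    fix x assume "x \<in> sumset (uminus ` A)"
    then obtain a b where "a \<in> A" "b \<in> A" "x = - (a + b)" unfolding sumset_def by auto
    then show "x \<in> uminus ` sumset A" unfolding sumset_def by blast
  next
    fix x assume "x \<in> uminus ` sumset A"
    then obtain a b where "a \<in> A" "b \<in> A" "x = - a + - b" unfolding sumset_def by auto
    then show "x \<in> sumset (uminus ` A)" unfolding sumset_def by blast
  qed
  then show ?thesis by (simp add: card_image)
qed

lemma prodset_uminus: "prodset (uminus ` A) = prodset A"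
proof (rule set_eqI, rule iffI)
  fix x assume "x \<in> prodset (uminus ` A)"
  then obtain a b where "a \<in> A" "b \<in> A" "x = a * b" unfolding prodset_def by auto
  then show "x \<in> prodset A" unfolding prodset_def by blast
next
  fix x assume "x \<in> prodset A"
  then obtain a b where "a \<in> A" "b \<in> A" "x = - a * - b" unfolding prodset_def by auto
  then show "x \<in> prodset (uminus ` A)" unfolding prodset_def by blast
qed

theorem theorem1p2:
  fixes \<epsilon> :: real
  assumes "\<epsilon> > 0"
  shows "\<exists>c > (0::real). \<forall>A :: real set. finite A \<longrightarrow>
           real (max (card (sumset A)) (card (prodset A)))
             \<ge> c * real (card A) powr (4/3 + 10/4407 - \<epsilon>)"
proof -
  obtain c where c: "c > 0" "\<And>A::real set. \<lbrakk>finite A; A \<noteq> {}; \<And>a. a \<in> A \<Longrightarrow> a > 0\<rbrakk> \<Longrightarrow>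
       c * real (card A) powr (4/3 + 10/4407) \<le> real (max (card (sumset A)) (card (prodset A)))"
    using sum_product_positive by blast
  define \<theta> where "\<theta> = (4/3 + 10/4407 :: real)"
  \<comment> \<open>A quarter of \<open>A\<close> has one sign, hence
    \<open>(1/4) powr \<theta>\<close>. The bound by 1 settles singletons, and for the empty set
    \<open>0 powr _\<close> is 0.\<close>
  define d where "d = min 1 (c * (1/4) powr \<theta>)"
  have d: "d > 0" unfolding d_def using c(1) by simp
  have "d * real (card A) powr (\<theta> - \<epsilon>) \<le> real (max (card (sumset A)) (card (prodset A)))"
    if finA: "finite A" for A :: "real set"
  proof (cases "card A \<le> 1")
    case True
    show ?thesis
    proof (cases "A = {}")
      case False
      then obtain a where "a \<in> A" by auto
      then have "a * a \<in> prodset A" unfolding prodset_def by auto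
      then have "card (prodset A) > 0" using finA by (auto simp: card_gt_0_iff)
      then have "1 \<le> real (max (card (sumset A)) (card (prodset A)))" by simp
      moreover have "card A = 1" using True False finA by (simp add: card_gt_0_iff le_antisym Suc_le_eq)
      ultimately show ?thesis unfolding d_def by simp
    qed simp
  next
    case False
    \<comment> \<open>With at least two elements, at least half of them are nonzero, so
      \<open>P\<close> or \<open>Q\<close> has at least a quarter of \<open>A\<close>. Negating
      \<open>Q\<close> reflects its sums and preserves its products.\<close>
    define P where "P = {a\<in>A. a > 0}"
    define Q where "Q = {a\<in>A. a < 0}"
    have "A \<subseteq> P \<union> Q \<union> {0}" unfolding P_def Q_def by auto
    then have "card A \<le> card (P \<union> Q \<union> {0})"
      by (rule card_mono[rotated]) (use finA in \<open>auto simp: P_def Q_def\<close>)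
    also have "\<dots> \<le> card P + card Q + 1"
      by (rule order_trans[OF card_Un_le]) (simp add: card_Un_le)
    finally have cPQ: "card A \<le> card P + card Q + 1" .
    have "\<exists>B. finite B \<and> card A \<le> 4 * card B \<and> (\<forall>b\<in>B. b > 0) \<and>
        card (sumset B) \<le> card (sumset A) \<and> card (prodset B) \<le> card (prodset A)"
    proof (cases "card A \<le> 4 * card P")
      case True
      have "sumset P \<subseteq> sumset A" "prodset P \<subseteq> prodset A" unfolding sumset_def prodset_def P_def by auto
      then have "card (sumset P) \<le> card (sumset A)" "card (prodset P) \<le> card (prodset A)"
        using finA by (auto intro!: card_mono)
      then show ?thesis using True finA by (intro exI[of _ P]) (auto simp: P_def)
    next
      case P4: False
      then have Q4: "card A \<le> 4 * card Q" using cPQ False by linarith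
      have "sumset Q \<subseteq> sumset A" "prodset Q \<subseteq> prodset A" unfolding sumset_def prodset_def Q_def by auto
      then have "card (sumset Q) \<le> card (sumset A)" "card (prodset Q) \<le> card (prodset A)"
        using finA by (auto intro!: card_mono)
      moreover have "card (uminus ` Q) = card Q" by (simp add: card_image)
      ultimately show ?thesis using Q4 finA
        by (intro exI[of _ "uminus ` Q"]) (auto simp: card_sumset_uminus prodset_uminus, auto simp: Q_def)
    qed
    then obtain B where B: "finite B" "card A \<le> 4 * card B" "\<And>b. b \<in> B \<Longrightarrow> b > 0"
      "card (sumset B) \<le> card (sumset A)" "card (prodset B) \<le> card (prodset A)" by blast
    have "B \<noteq> {}" using B(2) False by auto
    have n1: "real (card A) \<ge> 1" using False by simp
    have "d * real (card A) powr (\<theta> - \<epsilon>) \<le> d * real (card A) powr \<theta>"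
      using d n1 assms by (intro mult_left_mono powr_mono) auto
    also have "\<dots> \<le> c * (1/4) powr \<theta> * real (card A) powr \<theta>"
      unfolding d_def by (intro mult_right_mono) auto
    also have "\<dots> = c * (real (card A) / 4) powr \<theta>" by (simp add: powr_mult powr_divide)
    also have "\<dots> \<le> c * real (card B) powr \<theta>"
      using B(2) c(1) unfolding \<theta>_def by (intro mult_left_mono powr_mono2) auto
    also have "\<dots> \<le> real (max (card (sumset B)) (card (prodset B)))"
      unfolding \<theta>_def by (rule c(2)[OF B(1) \<open>B \<noteq> {}\<close> B(3)])
    also have "\<dots> \<le> real (max (card (sumset A)) (card (prodset A)))"
      using B(4,5) by (intro of_nat_mono max.mono)
    finally show ?thesis .
  qed
  then show ?thesis using d unfolding \<theta>_def by blast
qed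

end
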